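(* Let $2\le r<\infty$, $2^{r-1}\le n\le2^r-1$, and let $f:\mathbf R^n\to\mathcal A_r$ be an original. Then for each $p\in W_f$ and each $h=h_0i_0+\dots+h_ni_n\in\mathcal A_r$ with $h_0,\dots,h_n\in\mathbf R$, the (super)derivative of the image is: (1) for the spherical kernel (S), $$(\partial\mathcal F^n(f(t),u;p;\zeta)/\partial p).h=-\mathcal F^n(f(t)s_1,u;p;\zeta)h_0-\mathsf S_{e_1}\mathcal F^n(f(t)s_1,u;p;\zeta)h_1-\dots-\mathsf S_{e_n}\mathcal F^n(f(t)s_n,u;p;\zeta)h_n;$$ (1.1) for the Cartesian kernel (C), $$(\partial\mathcal F^n(f(t),u;p;\zeta)/\partial p).h=-\mathcal F^n(f(t)s_1,u;p;\zeta)h_0-\mathsf S_{e_1}\mathcal F^n(f(t)t_1,u;p;\zeta)h_1-\dots-\mathsf S_{e_n}\mathcal F^n(f(t)t_n,u;p;\zeta)h_n.$$ Here $s_j=t_j+\dots+t_n$ and $\mathsf S_{e_k}=-\partial/\partial\zeta_k$.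
   Context: Cayley–Dickson algebras: $\mathcal A_0=\mathbf R$ and $\mathcal A_{r+1}=\mathcal A_r\oplus\mathcal A_r\mathbf l$ with $(\xi+\eta\mathbf l)(\gamma+\delta\mathbf l)=(\xi\gamma-\delta^*\eta)+(\delta\xi+\eta\gamma^* )\mathbf l$, $(\xi+\eta\mathbf l)^*=\xi^*-\eta\mathbf l$. The standard basis of $\mathcal A_r$ is $i_0=1,i_1,\dots,i_{2^r-1}$, with $i_j^2=-1$, $i_ji_k=-i_ki_j$ for $j\ne k$, $j,k\ge1$. $\mathrm{Re}(z)=(z+z^* )/2$, $|z|^2=zz^*$, $\exp(z)=\sum_kz^k/k!$. Write $p=\sum_jp_ji_j$, $\zeta=\sum_j\zeta_ji_j$ with real $p_j,\zeta_j$. When $n<2^r-1$ one puts $p_m=\zeta_m=t_m=0$ for $m>n$. Originals: $f:\mathbf R^n\to\mathcal A_r$ is an original if (1) $f$ is continuous almost everywhere for the Lebesgue measure; (2) each partial function $t_j\mapsto f(t)$ has on each finite interval only finitely many discontinuities, all of the first kind; (3) each partial function $g_j(t_j)=f(t)$ satisfies, except possibly at its discontinuities of the first kind, a Hölder condition $|g_j(t_j+h)-g_j(t_j)|\le A_j|h|^{\alpha_j}$ for $|h|<\delta_j$, with constants $0<\alpha_j\le1$, $A_j,\delta_j>0$ (for the given $t$); (4) there are real $a_1(f),a_{-1}(f)$ and constants $C_v>0$ such that for each $v\in\{-1,1\}^n$, $|f(t)|<C_v\exp(\sum_ja_{v_j}t_j)$ whenever $v_jt_j\ge0$ for all $j$.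 $W_f=\{p\in\mathcal A_r:a_1(f)<\mathrm{Re}(p)<a_{-1}(f)\}$. Kernels: (C) Cartesian: $u(p,t;\zeta)=p_0(t_1+\dots+t_n)+\sum_{j=1}^np_jt_ji_j+\zeta$. (S) Spherical: with $s_j=t_j+\dots+t_n$, $K=2^r-1$, $\phi_j=p_js_j+\zeta_j$: $u=p_0s_1+M+\zeta_0$, $M=\phi_1[i_1\cos\phi_2+i_2\sin\phi_2\cos\phi_3+\dots+i_{K-1}\sin\phi_2\cdots\sin\phi_{K-1}\cos\phi_K+i_K\sin\phi_2\cdots\sin\phi_K]$. Transform: $\mathcal F^n(f,u;p;\zeta)=\int_{\mathbf R^n}f(t)\exp(-u(p,t;\zeta))\,dt$. $(\partial F/\partial p).h$ denotes the (Fréchet, $\mathbf R$-linear in $h$) derivative of $F$ in $p$ applied to the increment $h$. *)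

theory Defs
  imports "HOL-Analysis.Analysis"
begin

section \<open>The Cayley--Dickson algebras\<close>

text \<open>The doubling process on coordinate sequences: an element of the algebra of level \<open>r\<close> is
  given by its coordinates \<open>0, \<dots>, 2 ^ r - 1\<close>, the first half of the coordinates at level \<open>Suc r\<close>
  being those of \<open>\<xi>\<close> and the second half those of \<open>\<eta>\<close> in \<open>\<xi> + \<eta> l\<close>.  So the basis element with
  index \<open>2 ^ r + j\<close> is \<open>i\<^sub>j l\<close>.\<close>

definition cd_low :: "nat \<Rightarrow> (nat \<Rightarrow> real) \<Rightarrow> nat \<Rightarrow> real" where
  "cd_low r x = (\<lambda>m. if m < 2 ^ r then x m else 0)"

definition cd_high :: "nat \<Rightarrow> (nat \<Rightarrow> real) \<Rightarrow> nat \<Rightarrow> real" where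
  "cd_high r x = (\<lambda>m. if m < 2 ^ r then x (2 ^ r + m) else 0)"

definition cd_join :: "nat \<Rightarrow> (nat \<Rightarrow> real) \<Rightarrow> (nat \<Rightarrow> real) \<Rightarrow> nat \<Rightarrow> real" where
  "cd_join r \<xi> \<eta> = (\<lambda>m. if m < 2 ^ r then \<xi> m else \<eta> (m - 2 ^ r))"

fun cd_conj_seq :: "nat \<Rightarrow> (nat \<Rightarrow> real) \<Rightarrow> nat \<Rightarrow> real" where
  "cd_conj_seq 0 x = x"
| "cd_conj_seq (Suc r) x = cd_join r (cd_conj_seq r (cd_low r x)) (\<lambda>m. - cd_high r x m)"

fun cd_mult_seq :: "nat \<Rightarrow> (nat \<Rightarrow> real) \<Rightarrow> (nat \<Rightarrow> real) \<Rightarrow> nat \<Rightarrow> real" where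
  "cd_mult_seq 0 x y = (\<lambda>m. if m = 0 then x 0 * y 0 else 0)"
| "cd_mult_seq (Suc r) x y =
    (let \<xi> = cd_low r x; \<eta> = cd_high r x; \<gamma> = cd_low r y; \<delta> = cd_high r y in
     cd_join r
       (\<lambda>m. cd_mult_seq r \<xi> \<gamma> m - cd_mult_seq r (cd_conj_seq r \<delta>) \<eta> m)
       (\<lambda>m. cd_mult_seq r \<delta> \<xi> m + cd_mult_seq r \<eta> (cd_conj_seq r \<gamma>) m))"

text \<open>The level is the cardinality of the type parameter: \<open>2 cd\<close> are the quaternions, \<open>3 cd\<close> the
  octonions.  As \<open>CARD('r) = 0\<close> for infinite types, level 0 is covered as well.\<close>

typedef 'r cd = "{x :: nat \<Rightarrow> real. \<forall>m \<ge> 2 ^ CARD('r). x m = 0}"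
  morphisms cd_coord Abs_cd
  by (rule exI[of _ "\<lambda>_. 0"]) simp

definition cd_of :: "(nat \<Rightarrow> real) \<Rightarrow> 'r cd" where
  "cd_of x = Abs_cd (\<lambda>m. if m < 2 ^ CARD('r) then x m else 0)"

lemma cd_coord_of [simp]: "cd_coord (cd_of x :: 'r cd) m = (if m < 2 ^ CARD('r) then x m else 0)"
  unfolding cd_of_def by (subst Abs_cd_inverse) auto

lemma cd_coord_ge [simp]: "2 ^ CARD('r) \<le> m \<Longrightarrow> cd_coord (z :: 'r cd) m = 0"
  using cd_coord[of z] by simp

lemma cd_eqI:
  assumes "\<And>m. m < 2 ^ CARD('r) \<Longrightarrow> cd_coord (z :: 'r cd) m = cd_coord w m"
  shows "z = w"
proof -
  have "cd_coord z m = cd_coord w m" for m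
    using assms[of m] by (cases "m < 2 ^ CARD('r)") auto
  then show ?thesis by (simp add: cd_coord_inject[symmetric] fun_eq_iff)
qed

lemma cd_of_coord [simp]: "cd_of (cd_coord z) = z"
  by (rule cd_eqI) simp

definition cd_unit :: "nat \<Rightarrow> 'r cd" where
  "cd_unit j = cd_of (\<lambda>m. if m = j then 1 else 0)"

instantiation cd :: (type) real_vector
begin
definition "0 = (cd_of (\<lambda>_. 0) :: 'a cd)"
definition "z + w = (cd_of (\<lambda>m. cd_coord z m + cd_coord w m) :: 'a cd)"
definition "z - w = (cd_of (\<lambda>m. cd_coord z m - cd_coord w m) :: 'a cd)"
definition "- z = (cd_of (\<lambda>m. - cd_coord z m) :: 'a cd)"
definition "c *\<^sub>R z = (cd_of (\<lambda>m. c * cd_coord z m) :: 'a cd)"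
instance
  by standard
    (auto intro!: cd_eqI simp: zero_cd_def plus_cd_def minus_cd_def uminus_cd_def scaleR_cd_def
      algebra_simps)
end

lemma cd_coord_zero [simp]: "cd_coord 0 m = 0"
  by (simp add: zero_cd_def)
lemma cd_coord_add [simp]: "cd_coord (z + w) m = cd_coord z m + cd_coord w m"
  by (simp add: plus_cd_def)
lemma cd_coord_diff [simp]: "cd_coord (z - w) m = cd_coord z m - cd_coord w m"
  by (simp add: minus_cd_def)
lemma cd_coord_minus [simp]: "cd_coord (- z) m = - cd_coord z m"
  by (simp add: uminus_cd_def)
lemma cd_coord_scaleR [simp]: "cd_coord (c *\<^sub>R z) m = c * cd_coord z m"
  by (simp add: scaleR_cd_def)
lemma cd_coord_sum [simp]: "cd_coord (sum f A) m = (\<Sum>i\<in>A. cd_coord (f i) m)"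
  by (induction A rule: infinite_finite_induct) auto
lemma cd_coord_unit [simp]:
  "cd_coord (cd_unit j :: 'r cd) m = (if m = j \<and> j < 2 ^ CARD('r) then 1 else 0)"
  by (auto simp: cd_unit_def)

text \<open>The norm is the Euclidean norm of the coordinates; see \<open>cd_mult_cnj\<close> below for
  \<open>|z|\<^sup>2 = z z\<^sup>*\<close>.\<close>

instantiation cd :: (type) real_inner
begin
definition "inner z w = (\<Sum>m<2 ^ CARD('a). cd_coord z m * cd_coord (w :: 'a cd) m)"
definition "norm z = sqrt (inner z (z :: 'a cd))"
definition "sgn z = inverse (norm z) *\<^sub>R (z :: 'a cd)"
definition "dist z w = norm (z - w :: 'a cd)"
definition "uniformity =
  (INF e\<in>{0<..}. principal {(z :: 'a cd, w). dist z w < e})"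
definition "open (U :: 'a cd set) \<longleftrightarrow>
  (\<forall>z\<in>U. eventually (\<lambda>(z', w). z' = z \<longrightarrow> w \<in> U) uniformity)"
instance
proof
  fix x y z :: "'a cd" and c :: real
  show "inner x y = inner y x"
    by (simp add: inner_cd_def mult.commute)
  show "inner (x + y) z = inner x z + inner y z"
    by (simp add: inner_cd_def algebra_simps sum.distrib)
  show "inner (c *\<^sub>R x) y = c * inner x y"
    by (simp add: inner_cd_def sum_distrib_left mult.assoc)
  show "0 \<le> inner x x"
    by (simp add: inner_cd_def sum_nonneg)
  show "(inner x x = 0) = (x = 0)"
  proof
    assume "inner x x = 0"
    then have "\<forall>m\<in>{..<2 ^ CARD('a)}. cd_coord x m * cd_coord x m = 0"
      unfolding inner_cd_def by (subst (asm) sum_nonneg_eq_0_iff) auto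
    then show "x = 0" by (intro cd_eqI) simp
  qed (simp add: inner_cd_def)
qed (simp_all add: norm_cd_def sgn_cd_def dist_cd_def uniformity_cd_def open_cd_def)
end

lemma inner_cd_unit:
  assumes "j < 2 ^ CARD('r)"
  shows "inner z (cd_unit j :: 'r cd) = cd_coord z j"
proof -
  have "inner z (cd_unit j :: 'r cd) = (\<Sum>m<2 ^ CARD('r). if j = m then cd_coord z m else 0)"
    unfolding inner_cd_def using assms by (intro sum.cong) auto
  also have "\<dots> = cd_coord z j"
    using assms by (subst sum.delta') auto
  finally show ?thesis .
qed

instantiation cd :: (type) euclidean_space
begin
definition "Basis = (cd_unit ` {..<2 ^ CARD('a)} :: 'a cd set)"
instance
proof
  have "cd_unit 0 \<in> (Basis :: 'a cd set)" by (simp add: Basis_cd_def)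
  then show "(Basis :: 'a cd set) \<noteq> {}" by blast
  show "finite (Basis :: 'a cd set)" by (simp add: Basis_cd_def)
next
  fix u v :: "'a cd"
  assume "u \<in> Basis" "v \<in> Basis"
  then obtain j k where jk: "j < 2 ^ CARD('a)" "k < 2 ^ CARD('a)" "u = cd_unit j" "v = cd_unit k"
    by (auto simp: Basis_cd_def)
  have "u = v \<longleftrightarrow> j = k"
  proof
    assume "u = v"
    then have "cd_coord u k = cd_coord v k" by simp
    then show "j = k" using jk by (simp split: if_splits)
  qed (simp add: jk)
  then show "inner u v = (if u = v then 1 else 0)"
    using jk by (simp add: inner_cd_unit)
next
  fix z :: "'a cd"
  show "(\<forall>u\<in>Basis. inner z u = 0) = (z = 0)"
    by (auto simp: Basis_cd_def inner_cd_unit intro!: cd_eqI)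
qed
end

text \<open>No ring class is available, since the product is neither commutative nor associative for large
  levels.  The \<open>power\<close> instance makes \<open>z ^ Suc k = z * z ^ k\<close>.\<close>

instantiation cd :: (type) "{one, times}"
begin
definition "1 = (cd_unit 0 :: 'a cd)"
definition "z * w = (cd_of (cd_mult_seq CARD('a) (cd_coord z) (cd_coord w)) :: 'a cd)"
instance ..
end

instance cd :: (type) power ..

definition cd_cnj :: "'r cd \<Rightarrow> 'r cd" where
  "cd_cnj z = cd_of (cd_conj_seq CARD('r) (cd_coord z))"

definition cd_Re :: "'r cd \<Rightarrow> real" where
  "cd_Re z = cd_coord z 0"

definition cd_exp :: "'r cd \<Rightarrow> 'r cd" where
  "cd_exp z = (\<Sum>k. (1 / fact k) *\<^sub>R z ^ k)"

lemma cd_conj_seq_eq: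
  assumes "\<And>m. m \<ge> 2 ^ r \<Longrightarrow> x m = 0"
  shows "cd_conj_seq r x = (\<lambda>m. if m = 0 then x m else - x m)"
  using assms
proof (induction r arbitrary: x)
  case 0
  then show ?case by (auto simp: fun_eq_iff)
next
  case (Suc r)
  have low: "cd_conj_seq r (cd_low r x) = (\<lambda>m. if m = 0 then cd_low r x m else - cd_low r x m)"
    by (rule Suc.IH) (simp add: cd_low_def)
  show ?case
  proof
    fix m
    show "cd_conj_seq (Suc r) x m = (if m = 0 then x m else - x m)"
      unfolding cd_conj_seq.simps low using Suc.prems[of m]
      by (auto simp: cd_join_def cd_low_def cd_high_def)
  qed
qed

lemma cd_Re_eq: "cd_Re z *\<^sub>R 1 = (1 / 2) *\<^sub>R (z + cd_cnj z)"
proof -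
  have "cd_conj_seq CARD('a) (cd_coord z) = (\<lambda>m. if m = 0 then cd_coord z m else - cd_coord z m)"
    by (rule cd_conj_seq_eq) simp
  then show ?thesis
    by (intro cd_eqI) (simp add: cd_Re_def cd_cnj_def one_cd_def)
qed

lemma cd_conj_seq_uminus:
  "cd_conj_seq r (\<lambda>m. - x m) = (\<lambda>m. - cd_conj_seq r x m)"
proof (induction r arbitrary: x)
  case (Suc r)
  have "cd_low r (\<lambda>m. - x m) = (\<lambda>m. - cd_low r x m)" "cd_high r (\<lambda>m. - x m) = (\<lambda>m. - cd_high r x m)"
    by (auto simp: cd_low_def cd_high_def)
  then show ?case by (simp add: Suc.IH) (auto simp: cd_join_def)
qed simp

lemma cd_mult_seq_uminus:
  "cd_mult_seq r (\<lambda>m. - x m) y = (\<lambda>m. - cd_mult_seq r x y m)"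
  "cd_mult_seq r x (\<lambda>m. - y m) = (\<lambda>m. - cd_mult_seq r x y m)"
proof (induction r arbitrary: x y)
  case (Suc r)
  have [simp]: "cd_low r (\<lambda>m. - x m) = (\<lambda>m. - cd_low r x m)"
    "cd_high r (\<lambda>m. - x m) = (\<lambda>m. - cd_high r x m)" for x
    by (auto simp: cd_low_def cd_high_def)
  {
    case 1
    show ?case by (auto simp: Let_def cd_conj_seq_uminus Suc.IH cd_join_def)
  next
    case 2
    show ?case by (auto simp: Let_def cd_conj_seq_uminus Suc.IH cd_join_def)
  }
qed auto

lemma cd_mult_seq_cnj:
  assumes "\<And>m. m \<ge> 2 ^ r \<Longrightarrow> x m = 0"
  shows "cd_mult_seq r x (cd_conj_seq r x) = (\<lambda>m. if m = 0 then \<Sum>j<2 ^ r. x j * x j else 0) \<and>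
    cd_mult_seq r (cd_conj_seq r x) x = (\<lambda>m. if m = 0 then \<Sum>j<2 ^ r. x j * x j else 0)"
  using assms
proof (induction r arbitrary: x)
  case (Suc r)
  define \<xi> where "\<xi> = cd_low r x"
  define \<eta> where "\<eta> = cd_high r x"
  have \<xi>0: "\<And>m. m \<ge> 2 ^ r \<Longrightarrow> \<xi> m = 0" and \<eta>0: "\<And>m. m \<ge> 2 ^ r \<Longrightarrow> \<eta> m = 0"
    by (auto simp: \<xi>_def \<eta>_def cd_low_def cd_high_def)
  have cl: "cd_low r (cd_conj_seq (Suc r) x) = cd_conj_seq r \<xi>"
    and ch: "cd_high r (cd_conj_seq (Suc r) x) = (\<lambda>m. - \<eta> m)"
    unfolding cd_conj_seq.simps \<xi>_def[symmetric] \<eta>_def[symmetric] cd_conj_seq_eq[OF \<xi>0]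
    unfolding cd_low_def cd_high_def cd_join_def using \<xi>0 \<eta>0
    by (auto simp: cd_conj_seq_eq[OF \<xi>0] fun_eq_iff)
  have cc: "cd_conj_seq r (cd_conj_seq r \<xi>) = \<xi>"
    by (subst cd_conj_seq_eq) (auto simp: cd_conj_seq_eq[OF \<xi>0] \<xi>0)
  have sum: "(\<Sum>j<2 ^ Suc r. x j * x j) = (\<Sum>j<2 ^ r. \<xi> j * \<xi> j) + (\<Sum>j<2 ^ r. \<eta> j * \<eta> j)"
  proof -
    have "(\<Sum>j<2 ^ Suc r. x j * x j) = (\<Sum>j\<in>{..<2 ^ r} \<union> {2 ^ r..<2 ^ r + 2 ^ r}. x j * x j)"
      by (rule sum.cong) auto
    also have "\<dots> = (\<Sum>j<2 ^ r. x j * x j) + (\<Sum>j=2 ^ r..<2 ^ r + 2 ^ r. x j * x j)"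
      by (rule sum.union_disjoint) auto
    also have "(\<Sum>j=2 ^ r..<2 ^ r + 2 ^ r. x j * x j) = (\<Sum>j<2 ^ r. x (2 ^ r + j) * x (2 ^ r + j))"
      using sum.shift_bounds_nat_ivl[of "\<lambda>j. x j * x j" 0 "2 ^ r" "2 ^ r"]
      by (simp add: add.commute lessThan_atLeast0)
    finally show ?thesis by (simp add: \<xi>_def \<eta>_def cd_low_def cd_high_def)
  qed
  have IH: "cd_mult_seq r z (cd_conj_seq r z) = (\<lambda>m. if m = 0 then \<Sum>j<2 ^ r. z j * z j else 0)"
    "cd_mult_seq r (cd_conj_seq r z) z = (\<lambda>m. if m = 0 then \<Sum>j<2 ^ r. z j * z j else 0)"
    if "z = \<xi> \<or> z = \<eta>" for z
    using Suc.IH[of z] that \<xi>0 \<eta>0 by blast+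
  show ?case
    unfolding cd_mult_seq.simps Let_def cl ch \<xi>_def[symmetric] \<eta>_def[symmetric] sum
    by (auto simp: cc cd_conj_seq_uminus cd_mult_seq_uminus IH cd_join_def fun_eq_iff)
qed auto

lemma cd_mult_cnj: "z * cd_cnj z = (norm z)\<^sup>2 *\<^sub>R (1 :: 'r cd)"
proof -
  have supp: "\<And>m. m \<ge> 2 ^ CARD('r) \<Longrightarrow> cd_coord z m = 0" by simp
  have "cd_coord (cd_cnj z) = cd_conj_seq CARD('r) (cd_coord z)"
    by (auto simp: cd_cnj_def cd_conj_seq_eq[OF supp] fun_eq_iff)
  moreover have "(norm z)\<^sup>2 = (\<Sum>j<2 ^ CARD('r). cd_coord z j * cd_coord z j)"
    by (simp add: dot_square_norm[symmetric] inner_cd_def)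
  ultimately show ?thesis
    by (intro cd_eqI) (simp add: times_cd_def cd_mult_seq_cnj[OF supp] one_cd_def)
qed


section \<open>Originals\<close>

text \<open>\<open>R\<^sup>n\<close> is \<open>real ^ 'n\<close> with \<open>n = CARD('n)\<close>; the linear order on \<open>'n\<close> supplies the numbering of
  the coordinates \<open>t\<^sub>1, \<dots>, t\<^sub>n\<close>, and \<open>t\<^sub>m = 0\<close> for the other indices.\<close>

definition tc :: "real ^ 'n::{finite,linorder} \<Rightarrow> nat \<Rightarrow> real" where
  "tc t m = (if 1 \<le> m \<and> m \<le> CARD('n) then t $ (sorted_list_of_set UNIV ! (m - 1)) else 0)"

definition tsum :: "real ^ 'n::{finite,linorder} \<Rightarrow> nat \<Rightarrow> real" where
  "tsum t j = (\<Sum>m = j..CARD('n). tc t m)"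

definition partial_fun :: "(real ^ 'n \<Rightarrow> 'b) \<Rightarrow> real ^ 'n \<Rightarrow> 'n \<Rightarrow> real \<Rightarrow> 'b" where
  "partial_fun f t j x = f (\<chi> i. if i = j then x else t $ i)"

definition first_kind :: "(real \<Rightarrow> 'b::topological_space) \<Rightarrow> real \<Rightarrow> bool" where
  "first_kind g x \<longleftrightarrow>
    \<not> isCont g x \<and> (\<exists>l. (g \<longlongrightarrow> l) (at_left x)) \<and> (\<exists>l. (g \<longlongrightarrow> l) (at_right x))"

text \<open>The argument \<open>a\<close> collects the two exponents: \<open>a 1\<close> and \<open>a (- 1)\<close> are \<open>a\<^sub>1(f)\<close> and
  \<open>a\<^sub>-\<^sub>1(f)\<close>.  Any exponents for which the growth condition holds are allowed.\<close>

definition original :: "(int \<Rightarrow> real) \<Rightarrow> (real ^ 'n::finite \<Rightarrow> 'r cd) \<Rightarrow> bool" where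
  "original a f \<longleftrightarrow>
    (AE t in lebesgue. isCont f t) \<and>
    (\<forall>t j c d. finite {x \<in> {c..d}. \<not> isCont (partial_fun f t j) x}) \<and>
    (\<forall>t j x. \<not> isCont (partial_fun f t j) x \<longrightarrow> first_kind (partial_fun f t j) x) \<and>
    (\<forall>t j. \<not> first_kind (partial_fun f t j) (t $ j) \<longrightarrow>
      (\<exists>\<alpha> A \<delta>. 0 < \<alpha> \<and> \<alpha> \<le> 1 \<and> 0 < A \<and> 0 < \<delta> \<and>
        (\<forall>h. \<bar>h\<bar> < \<delta> \<longrightarrow>
          norm (partial_fun f t j (t $ j + h) - partial_fun f t j (t $ j)) \<le> A * \<bar>h\<bar> powr \<alpha>))) \<and>
    (\<forall>v :: 'n \<Rightarrow> int. range v \<subseteq> {-1, 1} \<longrightarrow>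
      (\<exists>C > 0. \<forall>t. (\<forall>j. of_int (v j) * t $ j \<ge> 0) \<longrightarrow>
        norm (f t) < C * exp (\<Sum>j\<in>UNIV. a (v j) * t $ j)))"

definition strip :: "(int \<Rightarrow> real) \<Rightarrow> 'r cd set" where
  "strip a = {p. a 1 < cd_Re p \<and> cd_Re p < a (- 1)}"


section \<open>Kernels and the transform\<close>

text \<open>The convention \<open>p\<^sub>m = \<zeta>\<^sub>m = t\<^sub>m = 0\<close> for \<open>m > n\<close> is carried out inside the kernels, which
  read only the coordinates up to \<open>n\<close> of \<open>p\<close> and \<open>\<zeta>\<close>; these parameters range over the whole
  algebra.\<close>

definition cd_trunc :: "nat \<Rightarrow> 'r cd \<Rightarrow> 'r cd" where
  "cd_trunc n z = cd_of (\<lambda>m. if m \<le> n then cd_coord z m else 0)"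

definition kernel_C :: "'r cd \<Rightarrow> real ^ 'n::{finite,linorder} \<Rightarrow> 'r cd \<Rightarrow> 'r cd" where
  "kernel_C p t \<zeta> =
    (cd_coord p 0 * tsum t 1) *\<^sub>R 1
    + (\<Sum>j = 1..CARD('n). (cd_coord p j * tc t j) *\<^sub>R cd_unit j)
    + cd_trunc CARD('n) \<zeta>"

definition kernel_S :: "'r cd \<Rightarrow> real ^ 'n::{finite,linorder} \<Rightarrow> 'r cd \<Rightarrow> 'r cd" where
  "kernel_S p t \<zeta> =
    (let K = 2 ^ CARD('r) - 1;
         \<phi> = (\<lambda>j. cd_coord (cd_trunc CARD('n) p) j * tsum t j
                  + cd_coord (cd_trunc CARD('n) \<zeta>) j)
     in (cd_coord p 0 * tsum t 1) *\<^sub>R 1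
        + \<phi> 1 *\<^sub>R
          ((\<Sum>k = 1..K - 1. ((\<Prod>m = 2..k. sin (\<phi> m)) * cos (\<phi> (k + 1))) *\<^sub>R cd_unit k)
            + (\<Prod>m = 2..K. sin (\<phi> m)) *\<^sub>R cd_unit K)
        + cd_coord \<zeta> 0 *\<^sub>R 1)"

definition integrand ::
  "(real ^ 'n \<Rightarrow> 'r cd) \<Rightarrow> ('r cd \<Rightarrow> real ^ 'n \<Rightarrow> 'r cd \<Rightarrow> 'r cd) \<Rightarrow> 'r cd \<Rightarrow> 'r cd \<Rightarrow> real ^ 'n \<Rightarrow> 'r cd"
  where "integrand f u p \<zeta> t = f t * cd_exp (- u p t \<zeta>)"

definition transform ::
  "(real ^ 'n::finite \<Rightarrow> 'r cd) \<Rightarrow> ('r cd \<Rightarrow> real ^ 'n \<Rightarrow> 'r cd \<Rightarrow> 'r cd) \<Rightarrow> 'r cd \<Rightarrow> 'r cd \<Rightarrow> 'r cd"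
  where "transform f u p \<zeta> = integral\<^sup>L lebesgue (integrand f u p \<zeta>)"

text \<open>\<open>S_op k G \<zeta>\<close> is \<open>- \<partial>G/\<partial>\<zeta>\<^sub>k\<close> at \<open>\<zeta>\<close>; \<open>S_defined k G \<zeta>\<close> says that this partial
  derivative exists.\<close>

definition S_defined :: "nat \<Rightarrow> ('r cd \<Rightarrow> 'r cd) \<Rightarrow> 'r cd \<Rightarrow> bool" where
  "S_defined k G \<zeta> \<longleftrightarrow> (\<lambda>x. G (\<zeta> + x *\<^sub>R cd_unit k)) differentiable (at (0 :: real))"

definition S_op :: "nat \<Rightarrow> ('r cd \<Rightarrow> 'r cd) \<Rightarrow> 'r cd \<Rightarrow> 'r cd" where
  "S_op k G \<zeta> = - vector_derivative (\<lambda>x. G (\<zeta> + x *\<^sub>R cd_unit k)) (at (0 :: real))"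

end

theory Submission
  imports Defs
begin

text \<open>Both kernels have the form \<open>u(p, t; \<zeta>) = V(T\<^sub>t p + \<zeta>)\<close>, where \<open>T\<^sub>t\<close> multiplies \<open>p\<^sub>0\<close> by \<open>s\<^sub>1\<close> and
  \<open>p\<^sub>j\<close> by \<open>s\<^sub>j\<close> or \<open>t\<^sub>j\<close>.  By the chain rule \<open>\<partial>/\<partial>p\<^sub>j\<close> of \<open>exp(-u)\<close> is that factor times
  \<open>\<partial>/\<partial>\<zeta>\<^sub>j\<close> of \<open>exp(-u)\<close>, and \<open>\<partial>/\<partial>\<zeta>\<^sub>0\<close> is multiplication by \<open>-1\<close> because
  \<open>V(x + c) = V(x) + c\<close> for real \<open>c\<close>.  Each \<open>z\<close> lies in a copy of the complex numbers, so \<open>exp\<close> has a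
  closed form whose derivative is bounded by a multiple of \<open>exp(Re z)\<close>.  In the strip the difference
  quotients are therefore dominated by a multiple of
  \<open>(1 + \<Sum>|t\<^sub>i|)\<^sup>3 exp(-d \<Sum>|t\<^sub>i|)\<close>, and one may differentiate under the integral.\<close>

section \<open>The product and the exponential\<close>

text \<open>The obstacle is the algebra itself: without associativity the powers in the exponential
  series have no convenient derivative, and from level 4 on the norm is not multiplicative. The
  closed form trades the series for real functions of Re z and |Im z|; the price is the point Im z =
  0, where the norm is not differentiable and which is treated separately. After that the product
  with \<open>f t\<close> is just a bounded linear map, which passes through derivatives. The point
  x = T p + \<zeta> is the only way in which p and \<zeta> enter, so one result on perturbing x by a
  family of linear maps M serves both sides of the formula: M = T with weight 1 for p, and M s = s
  i_k with a diagonal entry of T as weight for \<zeta>_k. The cube in the majorant collects one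
  linear factor from the weight, one from M, and one from the derivative of exp(-u) at x: the factor
  \<phi>_1 in front of the spherical direction makes that derivative grow linearly in x. The rate d
  is the distance of Re p from the ends of the strip, and half of it is given up so that the bounds
  hold uniformly near p.\<close>

lemma cd_low_linear:
  "cd_low r (\<lambda>m. a * x m + b * y m) = (\<lambda>m. a * cd_low r x m + b * cd_low r y m)"
  "cd_high r (\<lambda>m. a * x m + b * y m) = (\<lambda>m. a * cd_high r x m + b * cd_high r y m)"
  by (auto simp: cd_low_def cd_high_def)

lemma cd_conj_seq_linear:
  "cd_conj_seq r (\<lambda>m. a * x m + b * y m) = (\<lambda>m. a * cd_conj_seq r x m + b * cd_conj_seq r y m)"
proof (induction r arbitrary: x y)
  case (Suc r)
  show ?case
    by (simp add: cd_low_linear Suc.IH) (auto simp: cd_join_def fun_eq_iff)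
qed simp

text \<open>Doubling moves \<delta>, a half of the right factor, into left slots, so linearity in
  either slot at one level rests on linearity in both slots at the level below. Hence the
  simultaneous induction.\<close>

lemma cd_mult_seq_linear:
  "cd_mult_seq r (\<lambda>m. a * x m + b * y m) z =
    (\<lambda>m. a * cd_mult_seq r x z m + b * cd_mult_seq r y z m)"
  "cd_mult_seq r z (\<lambda>m. a * x m + b * y m) =
    (\<lambda>m. a * cd_mult_seq r z x m + b * cd_mult_seq r z y m)"
proof (induction r arbitrary: x y z)
  case 0
  {
    case 1 show ?case by (auto simp: algebra_simps)
  next
    case 2 show ?case by (auto simp: algebra_simps)
  }
next
  case (Suc r)
  {
    case 1
    show ?case
      by (simp add: Let_def cd_low_linear cd_conj_seq_linear Suc.IH)
        (auto simp: cd_join_def fun_eq_iff algebra_simps)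
  next
    case 2
    show ?case
      by (simp add: Let_def cd_low_linear cd_conj_seq_linear Suc.IH)
        (auto simp: cd_join_def fun_eq_iff algebra_simps)
  }
qed

text \<open>In finite dimension bilinearity already gives some constant K with |zw| \<le> K |z| |w|.
  From level 4 on K = 1 is no longer available, so K is carried through the later estimates.\<close>

lemma bounded_bilinear_cd_mult: "bounded_bilinear ((*) :: 'r cd \<Rightarrow> 'r cd \<Rightarrow> 'r cd)"
proof -
  have "linear (\<lambda>w. z * w :: 'r cd)" and "linear (\<lambda>w. w * z :: 'r cd)" for z :: "'r cd"
  proof -
    have lin: "cd_coord (a *\<^sub>R x + b *\<^sub>R y) = (\<lambda>m. a * cd_coord x m + b * cd_coord y m)"
      for a b and x y :: "'r cd"
      by auto
    have 1: "(a *\<^sub>R x + b *\<^sub>R y) * z = a *\<^sub>R (x * z) + b *\<^sub>R (y * z)" for a b and x y :: "'r cd"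
      by (rule cd_eqI) (simp add: times_cd_def lin cd_mult_seq_linear)
    have 2: "z * (a *\<^sub>R x + b *\<^sub>R y) = a *\<^sub>R (z * x) + b *\<^sub>R (z * y)" for a b and x y :: "'r cd"
      by (rule cd_eqI) (simp add: times_cd_def lin cd_mult_seq_linear)
    show "linear (\<lambda>w. z * w :: 'r cd)"
      using 2[of 1 _ 1] 2[of _ _ 0 0] by (intro linearI) auto
    show "linear (\<lambda>w. w * z :: 'r cd)"
      using 1[of 1 _ 1] 1[of _ _ 0 0] by (intro linearI) auto
  qed
  then show ?thesis
    by (simp add: bilinear_conv_bounded_bilinear[symmetric] bilinear_def)
qed

interpretation cd_mult: bounded_bilinear "(*) :: 'r cd \<Rightarrow> 'r cd \<Rightarrow> 'r cd"
  by (rule bounded_bilinear_cd_mult)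

lemma cd_mult_seq_unit:
  defines "e \<equiv> \<lambda>m::nat. if m = 0 then 1 else (0::real)"
  assumes "\<And>m. m \<ge> 2 ^ r \<Longrightarrow> x m = 0"
  shows "cd_mult_seq r e x = x \<and> cd_mult_seq r x e = x"
  using assms(2)
proof (induction r arbitrary: x)
  case 0
  then show ?case by (auto simp: e_def fun_eq_iff)
next
  case (Suc r)
  have low: "cd_low r e = e" and high: "cd_high r e = (\<lambda>_. 0)"
    by (auto simp: e_def cd_low_def cd_high_def)
  have conj: "cd_conj_seq r e = e"
    by (subst cd_conj_seq_eq) (auto simp: e_def intro!: gr0I)
  have zero: "cd_mult_seq r (\<lambda>_. 0) y = (\<lambda>_. 0)" "cd_mult_seq r y (\<lambda>_. 0) = (\<lambda>_. 0)"
    "cd_conj_seq r (\<lambda>_. 0) = (\<lambda>_. 0)" for y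
    using cd_mult_seq_linear(1)[of r 0 y 0 y y] cd_mult_seq_linear(2)[of r y 0 y 0 y]
      cd_conj_seq_linear[of r 0 y 0 y] by simp_all
  have IH: "cd_mult_seq r e y = y" "cd_mult_seq r y e = y"
    if "y = cd_low r x \<or> y = cd_high r x" for y
    using Suc.IH[of y] that by (auto simp: cd_low_def cd_high_def)
  show ?case
    using Suc.prems
    by (simp add: Let_def low high conj zero IH)
      (auto simp: cd_join_def cd_low_def cd_high_def fun_eq_iff)
qed

lemma cd_mult_1 [simp]: "1 * z = (z :: 'r cd)" "z * 1 = (z :: 'r cd)"
proof -
  have "cd_coord (1 :: 'r cd) = (\<lambda>m. if m = 0 then 1 else 0)"
    by (auto simp: one_cd_def)
  then show "1 * z = (z :: 'r cd)" "z * 1 = (z :: 'r cd)"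
    using cd_mult_seq_unit[of "CARD('r)" "cd_coord z"] by (simp_all add: times_cd_def)
qed

section \<open>The complex plane through an element, and the closed form of the exponential\<close>

definition cd_Im :: "'r cd \<Rightarrow> 'r cd" where
  "cd_Im z = z - cd_Re z *\<^sub>R 1"

lemma cd_coord_one [simp]: "cd_coord (1 :: 'r cd) m = (if m = 0 then 1 else 0)"
  by (simp add: one_cd_def)

lemma norm_cd_one [simp]: "norm (1 :: 'r cd) = 1"
  by (simp add: norm_cd_def inner_cd_def if_distrib[of "\<lambda>x. x * _"] cong: if_cong)

lemma abs_cd_coord_le: "\<bar>cd_coord z m\<bar> \<le> norm (z :: 'r cd)"
proof (cases "m < 2 ^ CARD('r)")
  case True
  then have "cd_unit m \<in> (Basis :: 'r cd set)"
    by (simp add: Basis_cd_def)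
  then show ?thesis
    using Basis_le_norm[of "cd_unit m" z] True by (simp add: inner_cd_unit)
qed simp

lemma bounded_linear_cd_coord: "bounded_linear (\<lambda>z :: 'r cd. cd_coord z m)"
  by (rule bounded_linear_intro[where K = 1]) (auto simp: abs_cd_coord_le)

text \<open>Conjugation negates a purely imaginary element, so this is z z* = |z|^2 read for
  \<open>cd_Im z\<close>.\<close>

lemma cd_Im_mult_self: "cd_Im z * cd_Im z = - (norm (cd_Im z))\<^sup>2 *\<^sub>R (1 :: 'r cd)"
proof -
  have "cd_cnj (cd_Im z) = - cd_Im z"
    by (rule cd_eqI) (auto simp: cd_cnj_def cd_conj_seq_eq cd_Im_def cd_Re_def)
  then show ?thesis
    using cd_mult_cnj[of "cd_Im z"] by (simp add: cd_mult.minus_right) (metis minus_minus)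
qed

text \<open>The span of \<open>1\<close> and \<open>Im z\<close> is a copy of the complex numbers.\<close>

lemma cd_power:
  fixes z :: "'r cd"
  defines "w \<equiv> Complex (cd_Re z) (norm (cd_Im z))"
  shows "z ^ k = Re (w ^ k) *\<^sub>R 1 + (Im (w ^ k) / norm (cd_Im z)) *\<^sub>R cd_Im z"
proof (induction k)
  case (Suc k)
  define v where "v = cd_Im z"
  define \<alpha> where "\<alpha> = Re (w ^ k)"
  define \<beta> where "\<beta> = Im (w ^ k) / norm v"
  have z: "z = cd_Re z *\<^sub>R 1 + v"
    by (simp add: v_def cd_Im_def)
  \<comment> \<open>For v = 0 the quotient \<beta> is 0 by the convention on division by zero, and
    both sides vanish; real z therefore fits the same formula.\<close>
  have \<beta>: "Im (w ^ k) * norm v = \<beta> * (norm v)\<^sup>2"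
    by (cases "norm v = 0") (auto simp: \<beta>_def power2_eq_square simp del: norm_eq_zero)
  have \<beta>': "\<alpha> *\<^sub>R v = (\<alpha> * norm v / norm v) *\<^sub>R v"
    by auto
  \<comment> \<open>The left factor z meets a power that already lies in the span of 1 and v, so
    bilinearity and v v = -|v|^2 determine the product.\<close>
  have "z ^ Suc k = (cd_Re z *\<^sub>R 1 + v) * (\<alpha> *\<^sub>R 1 + \<beta> *\<^sub>R v)"
    using Suc z by (simp add: \<alpha>_def \<beta>_def v_def)
  also have "\<dots> = (cd_Re z * \<alpha> - \<beta> * (norm v)\<^sup>2) *\<^sub>R 1 + (cd_Re z * \<beta>) *\<^sub>R v + \<alpha> *\<^sub>R v"
    by (simp add: cd_mult.add_left cd_mult.add_right cd_mult.scaleR_left cd_mult.scaleR_right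
        v_def cd_Im_mult_self algebra_simps)
  also have "\<dots> = Re (w ^ Suc k) *\<^sub>R 1 + (Im (w ^ Suc k) / norm v) *\<^sub>R v"
    by (subst \<beta>', subst \<beta>[symmetric])
      (simp add: \<alpha>_def \<beta>_def w_def v_def[symmetric] add_divide_distrib scaleR_add_left mult.commute)
  finally show ?case by (simp add: v_def)
qed simp

text \<open>Real and imaginary parts of the complex series for w = Re z + i |Im z|, taken term by
  term, are the two coefficients. At Im z = 0 the quotient has the value 0 instead of 1, but it
  multiplies the zero vector.\<close>

lemma cd_exp_eq:
  "cd_exp z = exp (cd_Re z) *\<^sub>R
    (cos (norm (cd_Im z)) *\<^sub>R 1 + (sin (norm (cd_Im z)) / norm (cd_Im z)) *\<^sub>R cd_Im (z :: 'r cd))"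
proof -
  define w where "w = Complex (cd_Re z) (norm (cd_Im z))"
  have s: "(\<lambda>k. w ^ k /\<^sub>R fact k) sums exp w"
    by (rule exp_converges)
  have "(\<lambda>k. Re (w ^ k /\<^sub>R fact k) *\<^sub>R 1 + (Im (w ^ k /\<^sub>R fact k) / norm (cd_Im z)) *\<^sub>R cd_Im z)
     sums (Re (exp w) *\<^sub>R 1 + (Im (exp w) / norm (cd_Im z)) *\<^sub>R cd_Im z)"
    by (intro sums_add sums_scaleR_left sums_divide sums_Re sums_Im s)
  moreover have "(\<lambda>k. Re (w ^ k /\<^sub>R fact k) *\<^sub>R 1 + (Im (w ^ k /\<^sub>R fact k) / norm (cd_Im z)) *\<^sub>R cd_Im z)
     = (\<lambda>k. (1 / fact k) *\<^sub>R z ^ k)"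
    by (subst cd_power) (simp add: w_def scaleR_add_right divide_simps)
  ultimately have "cd_exp z = Re (exp w) *\<^sub>R 1 + (Im (exp w) / norm (cd_Im z)) *\<^sub>R cd_Im z"
    unfolding cd_exp_def by (simp add: sums_iff)
  then show ?thesis
    by (simp add: w_def Re_exp Im_exp scaleR_add_right)
qed

section \<open>Size and derivative of the exponential\<close>

lemma bounded_linear_cd_Re: "bounded_linear cd_Re"
  using bounded_linear_cd_coord[of 0] by (simp add: cd_Re_def[abs_def])

lemma bounded_linear_cd_Im: "bounded_linear cd_Im"
  unfolding cd_Im_def[abs_def]
  by (intro bounded_linear_sub bounded_linear_ident bounded_linear_scaleR_const bounded_linear_cd_Re)

lemma norm_cd_Im_le: "norm (cd_Im z) \<le> norm (z :: 'r cd)"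
  unfolding norm_cd_def inner_cd_def cd_Im_def cd_Re_def
  by (intro real_sqrt_le_mono sum_mono) auto

lemma cd_Re_le_norm: "\<bar>cd_Re z\<bar> \<le> norm z"
  by (simp add: cd_Re_def abs_cd_coord_le)

text \<open>Away from 0 this is the chain rule. At 0 the norm has no derivative, but cos y - 1 =
  o(y) makes the composite flat there.\<close>

lemma has_derivative_cos_norm:
  fixes v :: "'a::real_inner"
  shows "\<exists>D. ((\<lambda>v. cos (norm v)) has_derivative D) (at v) \<and> (\<forall>h. \<bar>D h\<bar> \<le> norm h)"
proof (cases "v = 0")
  case False
  have "((\<lambda>v. cos (norm v)) has_derivative (\<lambda>h. - sin (norm v) * inner h (sgn v))) (at v)"
    using False by (auto intro!: derivative_eq_intros has_derivative_norm)
  moreover have "\<bar>- sin (norm v) * inner h (sgn v)\<bar> \<le> 1 * norm h" for h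
    unfolding abs_mult using Cauchy_Schwarz_ineq2[of h "sgn v"] False
    by (intro mult_mono) (auto simp: norm_sgn)
  ultimately show ?thesis
    by (intro exI conjI) auto
next
  case True
  have "((\<lambda>y. (cos y - 1) / y) \<longlongrightarrow> 0) (at (0::real))"
    using DERIV_cos[of 0] by (simp add: has_field_derivative_iff)
  moreover have "filterlim norm (at 0) (at (0::'a))"
    unfolding filterlim_at
    by (auto simp: eventually_at_filter intro: tendsto_norm_zero)
  ultimately have "((\<lambda>h::'a. (cos (norm h) - 1) / norm h) \<longlongrightarrow> 0) (at 0)"
    by (rule filterlim_compose)
  then have "((\<lambda>h::'a. norm ((cos (norm h) - 1) / norm h)) \<longlongrightarrow> 0) (at 0)"
    by (rule tendsto_norm_zero)
  then have "((\<lambda>v::'a. cos (norm v)) has_derivative (\<lambda>h. 0)) (at v)"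
    unfolding has_derivative_at using True by simp
  then show ?thesis
    by (intro exI[of _ "\<lambda>h. 0"]) auto
qed

text \<open>Away from 0 the product rule gives (sin|v|/|v|) h, of size at most |h|, plus a radial
  term of size at most 2|h|; hence the 3. At 0 the derivative is the identity, because sin y / y
  tends to 1.\<close>

lemma has_derivative_sin_norm_scaleR:
  fixes v :: "'a::real_inner"
  shows "\<exists>D. ((\<lambda>v. (sin (norm v) / norm v) *\<^sub>R v) has_derivative D) (at v) \<and>
    (\<forall>h. norm (D h) \<le> 3 * norm h)"
proof (cases "v = 0")
  case False
  define c where "c = (cos (norm v) * norm v - sin (norm v)) / (norm v * norm v)"
  define D where "D = (\<lambda>h. (sin (norm v) / norm v) *\<^sub>R h + (inner h (sgn v) * c) *\<^sub>R v)"
  have s: "\<bar>sin (norm v) / norm v\<bar> \<le> 1"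
    using abs_sin_x_le_abs_x[of "norm v"] False by simp
  have c: "norm (c *\<^sub>R v) \<le> 2"
  proof -
    have "c * norm v = cos (norm v) - sin (norm v) / norm v"
      using False by (simp add: c_def field_simps)
    then have "norm (c *\<^sub>R v) = \<bar>cos (norm v) - sin (norm v) / norm v\<bar>"
      by (metis abs_mult abs_norm_cancel norm_scaleR)
    then show ?thesis
      using s abs_cos_le_one[of "norm v"] by linarith
  qed
  have "((\<lambda>y. sin y / y) has_real_derivative c) (at (norm v))"
    unfolding c_def using False by (auto intro!: derivative_eq_intros)
  from has_derivative_scaleR[OF DERIV_compose_FDERIV[OF this has_derivative_norm[OF False]]
      has_derivative_ident]
  have "((\<lambda>v. (sin (norm v) / norm v) *\<^sub>R v) has_derivative D) (at v)"
    unfolding D_def .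
  moreover have "norm (D h) \<le> 3 * norm h" for h
  proof -
    have "norm (D h) \<le> \<bar>sin (norm v) / norm v\<bar> * norm h + \<bar>inner h (sgn v)\<bar> * norm (c *\<^sub>R v)"
      unfolding D_def by (rule order.trans[OF norm_triangle_ineq]) (simp add: abs_mult)
    also have "\<dots> \<le> 1 * norm h + norm h * 2"
      using s c Cauchy_Schwarz_ineq2[of h "sgn v"] False
      by (intro add_mono mult_mono) (simp_all add: norm_sgn)
    finally show ?thesis by simp
  qed
  ultimately show ?thesis by blast
next
  case True
  have "((\<lambda>y. sin y / y) \<longlongrightarrow> 1) (at (0::real))"
    using DERIV_sin[of 0] by (simp add: has_field_derivative_iff)
  moreover have "filterlim norm (at 0) (at (0::'a))"
    unfolding filterlim_at
    by (auto simp: eventually_at_filter intro: tendsto_norm_zero)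
  ultimately have "((\<lambda>h::'a. sin (norm h) / norm h) \<longlongrightarrow> 1) (at 0)"
    by (rule filterlim_compose)
  then have "((\<lambda>h::'a. \<bar>sin (norm h) / norm h - 1\<bar>) \<longlongrightarrow> 0) (at 0)"
    using tendsto_rabs_zero LIM_zero by blast
  moreover have "norm ((sin (norm h) / norm h) *\<^sub>R h - h) / norm h = \<bar>sin (norm h) / norm h - 1\<bar>"
    if "h \<noteq> 0" for h :: 'a
  proof -
    have "(sin (norm h) / norm h) *\<^sub>R h - h = (sin (norm h) / norm h - 1) *\<^sub>R h"
      by (simp add: algebra_simps)
    then show ?thesis
      using that by simp
  qed
  ultimately have "((\<lambda>h::'a. norm ((sin (norm h) / norm h) *\<^sub>R h - h) / norm h) \<longlongrightarrow> 0) (at 0)"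
    by (subst tendsto_cong) (auto simp: eventually_at_filter)
  then have "((\<lambda>v::'a. (sin (norm v) / norm v) *\<^sub>R v) has_derivative (\<lambda>h. h)) (at v)"
    unfolding has_derivative_at using True by simp
  then show ?thesis
    by (intro exI[of _ "\<lambda>h. h"]) auto
qed

lemma norm_cd_exp_le: "norm (cd_exp z) \<le> 2 * exp (cd_Re z)"
proof -
  have "norm ((sin y / y) *\<^sub>R cd_Im z) \<le> 1" if "y = norm (cd_Im z)" for y
    using that by simp
  then have "norm (cos (norm (cd_Im z)) *\<^sub>R 1 + (sin (norm (cd_Im z)) / norm (cd_Im z)) *\<^sub>R cd_Im z) \<le> 1 + 1"
    by (intro norm_triangle_le add_mono) auto
  then show ?thesis
    unfolding cd_exp_eq by simp
qed

text \<open>Product rule for exp(Re z) G(Im z): differentiating G contributes 1 + 3, and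
  differentiating the real exponential contributes |G| \<le> 2, in total 6.\<close>

lemma has_derivative_cd_exp:
  "\<exists>D. (cd_exp has_derivative D) (at z) \<and> (\<forall>h. norm (D h) \<le> 6 * exp (cd_Re z) * norm (h :: 'r cd))"
proof -
  define w where "w = cd_Im z"
  define G where "G = (\<lambda>v :: 'r cd. cos (norm v) *\<^sub>R 1 + (sin (norm v) / norm v) *\<^sub>R v)"
  obtain D1 where D1: "((\<lambda>v. cos (norm v)) has_derivative D1) (at w)" "\<And>h. \<bar>D1 h\<bar> \<le> norm h"
    using has_derivative_cos_norm by blast
  obtain D2 where D2: "((\<lambda>v. (sin (norm v) / norm v) *\<^sub>R v) has_derivative D2) (at w)"
    "\<And>h. norm (D2 h) \<le> 3 * norm h"
    using has_derivative_sin_norm_scaleR by blast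
  have G: "(G has_derivative (\<lambda>h. D1 h *\<^sub>R 1 + D2 h)) (at w)"
    unfolding G_def by (intro has_derivative_add has_derivative_scaleR_left D1 D2)
  have Im: "(cd_Im has_derivative cd_Im) (at z)"
    using bounded_linear.has_derivative[OF bounded_linear_cd_Im has_derivative_ident] .
  have Re: "(cd_Re has_derivative cd_Re) (at z)"
    using bounded_linear.has_derivative[OF bounded_linear_cd_Re has_derivative_ident] .
  define D where "D = (\<lambda>h. exp (cd_Re z) *\<^sub>R (D1 (cd_Im h) *\<^sub>R 1 + D2 (cd_Im h)) +
      (exp (cd_Re z) * cd_Re h) *\<^sub>R G w)"
  have "((\<lambda>z. exp (cd_Re z) *\<^sub>R G (cd_Im z)) has_derivative D) (at z)"
    unfolding D_def w_def
    by (rule has_derivative_scaleR[OF _ has_derivative_compose[OF Im G[unfolded w_def]]])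
      (auto intro!: derivative_eq_intros Re)
  then have "(cd_exp has_derivative D) (at z)"
    by (simp add: cd_exp_eq[abs_def] G_def)
  moreover have "norm (D h) \<le> 6 * exp (cd_Re z) * norm h" for h
  proof -
    have "norm ((sin y / y) *\<^sub>R w) \<le> 1" if "y = norm w" for y
      using that by simp
    then have "norm (G w) \<le> 1 + 1"
      unfolding G_def by (intro norm_triangle_le add_mono) auto
    moreover have "norm (D1 (cd_Im h) *\<^sub>R 1 + D2 (cd_Im h)) \<le> norm h + 3 * norm h"
      using D1(2)[of "cd_Im h"] D2(2)[of "cd_Im h"] norm_cd_Im_le[of h]
      by (intro norm_triangle_le add_mono) simp_all
    ultimately have "norm (D h) \<le> exp (cd_Re z) * (norm h + 3 * norm h) + (exp (cd_Re z) * norm h) * (1 + 1)"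
      unfolding D_def using cd_Re_le_norm[of h]
      by (intro norm_triangle_le add_mono) (simp_all add: abs_mult mult_mono)
    then show ?thesis by (simp add: algebra_simps)
  qed
  ultimately show ?thesis by blast
qed

lemma cd_exp_add_real: "cd_exp (z + c *\<^sub>R 1) = exp c *\<^sub>R cd_exp (z :: 'r cd)"
proof -
  have "cd_Im (z + c *\<^sub>R 1) = cd_Im z" "cd_Re (z + c *\<^sub>R 1) = cd_Re z + c"
    by (simp_all add: cd_Im_def cd_Re_def algebra_simps)
  then show ?thesis
    by (simp add: cd_exp_eq exp_add mult.commute)
qed

section \<open>Differentiation under the integral sign\<close>

text \<open>The l1 norm is the one adapted to originals: their growth bound is linear on each
  orthant, and exp(-d |t|) splits into a product over the coordinates.\<close>

definition abs_sum :: "real ^ 'n \<Rightarrow> real" where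
  "abs_sum t = (\<Sum>i\<in>UNIV. \<bar>t $ i\<bar>)"

lemma abs_sum_nonneg [simp]: "0 \<le> abs_sum t"
  by (simp add: abs_sum_def sum_nonneg)

lemma continuous_on_abs_sum: "continuous_on A abs_sum"
  unfolding abs_sum_def[abs_def] by (intro continuous_intros)

section \<open>Integrable majorants\<close>

lemma continuous_imp_borel_measurable_lebesgue:
  "continuous_on UNIV f \<Longrightarrow> f \<in> borel_measurable lebesgue"
  by (intro measurable_completion) (simp add: borel_measurable_continuous_onI)

text \<open>The half-line integrand \<open>g\<close> plus its reflection dominates the two-sided
  exponential; at 0 both are present, which only helps.\<close>

lemma integrable_exp_minus_abs:
  assumes "0 < (d::real)"
  shows "integrable lborel (\<lambda>x::real. exp (- d * \<bar>x\<bar>))"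
proof -
  define g where "g = (\<lambda>x::real. indicator {0..} x * exp (- d * x))"
  have "set_integrable lebesgue {0..} (\<lambda>x. exp (- d * x))"
    using assms by (intro nonnegative_absolutely_integrable_1 integrable_on_exp_minus_to_infinity) auto
  then have g: "integrable lborel g"
    unfolding g_def set_integrable_def by (subst integrable_completion[symmetric]) auto
  then have "integrable lborel (\<lambda>x. g (0 + (- 1) * x))"
    by (subst lborel_integrable_real_affine_iff) auto
  from Bochner_Integration.integrable_add[OF g this] show ?thesis
    by (rule Bochner_Integration.integrable_bound) (auto simp: g_def indicator_def)
qed

lemma integrable_exp_minus_abs_sum:
  assumes "0 < d"
  shows "integrable lborel (\<lambda>t :: real ^ 'n. exp (- d * abs_sum t))"
proof -
  have basis: "(Basis :: (real ^ 'n) set) = range (\<lambda>i. axis i 1)"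
    by (auto simp: Basis_vec_def)
  have inj: "inj (\<lambda>i. axis i (1::real) :: real ^ 'n)"
    by (auto intro!: injI simp: axis_eq_axis)
  have prod: "exp (- d * abs_sum t) = (\<Prod>b\<in>Basis. exp (- d * \<bar>t \<bullet> b\<bar>))" for t :: "real ^ 'n"
    unfolding basis prod.reindex[OF inj]
    by (simp add: abs_sum_def sum_distrib_left exp_sum cart_eq_inner_axis[symmetric] sum_negf[symmetric])
  have 1: "(\<integral>\<^sup>+x. ennreal (exp (- d * \<bar>x\<bar>)) \<partial>lborel) < \<infinity>"
    using integrable_exp_minus_abs[OF assms] by (simp add: integrable_iff_bounded)
  have "(\<integral>\<^sup>+t. ennreal (exp (- d * abs_sum (t :: real ^ 'n))) \<partial>lborel) =
      (\<integral>\<^sup>+t. (\<Prod>b\<in>Basis. ennreal (exp (- d * \<bar>(t :: real ^ 'n) \<bullet> b\<bar>))) \<partial>lborel)"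
    unfolding prod by (subst prod_ennreal) auto
  also have "\<dots> = (\<Prod>b\<in>(Basis :: (real ^ 'n) set). (\<integral>\<^sup>+x. ennreal (exp (- d * \<bar>x\<bar>)) \<partial>lborel))"
    by (rule nn_integral_lborel_prod) auto
  also have "\<dots> < \<infinity>"
    using 1 by (simp add: ennreal_prod_eq_top less_top power_less_top_ennreal)
  finally show ?thesis
    by (simp add: integrable_iff_bounded borel_measurable_continuous_onI
        continuous_intros continuous_on_abs_sum)
qed

text \<open>Half of the decay absorbs the polynomial: 1 + y \<le> K (1 + c y) \<le> K exp(c y), with
  c so small that m c \<le> d / 2. The denominator m + 1 keeps c defined for m = 0.\<close>

lemma power_mult_exp_le:
  assumes "0 < d"
  shows "\<exists>K. \<forall>y\<ge>0. (1 + y) ^ m * exp (- d * y) \<le> K * exp (- (d / 2) * (y::real))"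
proof -
  define c where "c = d / (2 * (real m + 1))"
  define K where "K = max 1 (1 / c)"
  have c: "0 < c" using assms by (simp add: c_def)
  have K: "1 \<le> K" "1 \<le> K * c"
    using c by (auto simp: K_def max_def field_simps)
  have "(1 + y) ^ m * exp (- d * y) \<le> K ^ m * exp (- (d / 2) * y)" if "0 \<le> y" for y
  proof -
    have "1 + y \<le> K + K * c * y"
      using K that mult_right_mono[of 1 "K * c" y] by simp
    also have "\<dots> = K * (1 + c * y)"
      by (simp add: algebra_simps)
    also have "\<dots> \<le> K * exp (c * y)"
      using K by (intro mult_left_mono exp_ge_add_one_self) auto
    finally have "(1 + y) ^ m \<le> (K * exp (c * y)) ^ m"
      using that by (intro power_mono) auto
    also have "\<dots> = K ^ m * exp (real m * (c * y))"
      by (simp add: power_mult_distrib exp_of_nat_mult)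
    also have "\<dots> \<le> K ^ m * exp (d / 2 * y)"
    proof -
      have "real m * c \<le> (real m + 1) * c"
        using c by simp
      also have "\<dots> = d / 2"
        by (simp add: c_def field_simps)
      finally show ?thesis
        using K that mult_right_mono[of "real m * c" "d / 2" y]
        by (intro mult_left_mono) (auto simp: mult.assoc)
    qed
    finally have "(1 + y) ^ m * exp (- d * y) \<le> K ^ m * exp (d / 2 * y) * exp (- d * y)"
      by (intro mult_right_mono) auto
    also have "\<dots> = K ^ m * exp (- (d / 2) * y)"
      by (simp add: mult.assoc exp_add[symmetric])
    finally show ?thesis .
  qed
  then show ?thesis by blast
qed

lemma integrable_power_mult_exp_abs_sum:
  assumes "0 < d"
  shows "integrable lebesgue (\<lambda>t :: real ^ 'n. (1 + abs_sum t) ^ m * exp (- d * abs_sum t))"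
proof -
  obtain K where K: "\<And>y. 0 \<le> y \<Longrightarrow> (1 + y) ^ m * exp (- d * y) \<le> K * exp (- (d / 2) * y)"
    using power_mult_exp_le[OF assms] by blast
  have "integrable lborel (\<lambda>t :: real ^ 'n. K * exp (- (d / 2) * abs_sum t))"
    using assms by (intro integrable_mult_right integrable_exp_minus_abs_sum) auto
  then have "integrable lborel (\<lambda>t :: real ^ 'n. (1 + abs_sum t) ^ m * exp (- d * abs_sum t))"
  proof (rule Bochner_Integration.integrable_bound)
    show "AE t in lborel. norm ((1 + abs_sum (t :: real ^ 'n)) ^ m * exp (- d * abs_sum t))
        \<le> norm (K * exp (- (d / 2) * abs_sum t))"
    proof (intro always_eventually allI)
      fix t :: "real ^ 'n"
      show "norm ((1 + abs_sum t) ^ m * exp (- d * abs_sum t)) \<le> norm (K * exp (- (d / 2) * abs_sum t))"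
        using K[OF abs_sum_nonneg, of t] by (simp add: order.trans[OF _ abs_ge_self])
    qed
  qed (simp add: borel_measurable_continuous_onI continuous_intros continuous_on_abs_sum)
  then show ?thesis
    by (subst integrable_completion) (auto intro: borel_measurable_integrable)
qed

section \<open>Dominated differentiation under an integral\<close>

lemma has_derivative_imp_scaled_difference:
  fixes f :: "'a::real_normed_vector \<Rightarrow> 'b::real_normed_vector"
  assumes "(f has_derivative D) (at p)"
  shows "((\<lambda>s::real. (1 / s) *\<^sub>R (f (p + s *\<^sub>R h) - f p)) \<longlongrightarrow> D h) (at 0)"
proof -
  have D: "(f has_derivative D) (at (p + 0 *\<^sub>R h))"
    using assms by simp
  have "((\<lambda>s::real. p + s *\<^sub>R h) has_derivative (\<lambda>s. s *\<^sub>R h)) (at 0)"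
    by (auto intro!: derivative_eq_intros)
  from has_derivative_compose[OF this D]
  have "((\<lambda>s. f (p + s *\<^sub>R h)) has_derivative (\<lambda>s. D (s *\<^sub>R h))) (at 0)" .
  then have "((\<lambda>s. f (p + s *\<^sub>R h)) has_vector_derivative D h) (at 0)"
    by (simp add: has_vector_derivative_def linear_scale[OF has_derivative_linear[OF assms]])
  then have "((\<lambda>s. norm (f (p + s *\<^sub>R h) - f p - s *\<^sub>R D h) / norm s) \<longlongrightarrow> 0) (at 0)"
    by (simp add: has_vector_derivative_def has_derivative_at)
  moreover have "norm (f (p + s *\<^sub>R h) - f p - s *\<^sub>R D h) / norm s =
      norm ((1 / s) *\<^sub>R (f (p + s *\<^sub>R h) - f p) - D h)" if "s \<noteq> 0" for s
  proof -
    have "(1 / s) *\<^sub>R (f (p + s *\<^sub>R h) - f p) - D h = (1 / s) *\<^sub>R (f (p + s *\<^sub>R h) - f p - s *\<^sub>R D h)"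
      using that by (simp add: scaleR_diff_right)
    then show ?thesis by simp
  qed
  ultimately have "((\<lambda>s. norm ((1 / s) *\<^sub>R (f (p + s *\<^sub>R h) - f p) - D h)) \<longlongrightarrow> 0) (at 0)"
    by (subst tendsto_cong[where g = "\<lambda>s. norm (f (p + s *\<^sub>R h) - f p - s *\<^sub>R D h) / norm s"])
      (auto simp: eventually_at_filter)
  then show ?thesis
    by (rule LIM_zero_cancel[OF tendsto_norm_zero_cancel])
qed

text \<open>A Lipschitz bound with integrable constant L(t) near p dominates the remainder quotients
  for every direction of h at once, so dominated convergence yields a Frechet derivative and not
  merely directional ones.\<close>

lemma has_derivative_integral_dominated:
  fixes G :: "'a::real_normed_vector \<Rightarrow> 't \<Rightarrow> 'b::euclidean_space"
  assumes e: "0 < e"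
    and int: "\<And>h. norm h < e \<Longrightarrow> integrable M (G (p + h))"
    and deriv: "\<And>t. ((\<lambda>q. G q t) has_derivative G' t) (at p)"
    and lip: "\<And>t h. norm h < e \<Longrightarrow> norm (G (p + h) t - G p t) \<le> L t * norm h"
    and L: "integrable M L"
  shows "integrable M (\<lambda>t. G' t h)"
    and "((\<lambda>q. \<integral>t. G q t \<partial>M) has_derivative (\<lambda>h. \<integral>t. G' t h \<partial>M)) (at p)"
proof -
  have intp: "integrable M (G p)"
    using int[of 0] e by simp
  have both: "integrable M (\<lambda>t. G' t h) \<and> (\<forall>t. norm (G' t h) \<le> L t * norm h)" for h
  proof -
    \<comment> \<open>Step sizes tending to 0 with s_k h inside the ball of radius e; the 1 + |h|
      covers h = 0 too.\<close>
    define s where "s = (\<lambda>k::nat. e / (1 + norm h) / real (Suc k))"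
    have s0: "0 < s k" for k
      unfolding s_def using e by (intro divide_pos_pos add_pos_nonneg) auto
    have s1: "norm (s k *\<^sub>R h) < e" for k
    proof -
      have "e / (1 + norm h) / real (Suc k) \<le> e / (1 + norm h) / 1"
        using e by (intro divide_left_mono) (auto simp: add_pos_nonneg)
      then have "s k \<le> e / (1 + norm h)"
        by (simp add: s_def)
      then have "s k * norm h \<le> e / (1 + norm h) * norm h"
        by (intro mult_right_mono) auto
      also have "\<dots> < e"
        using e by (simp add: field_simps add_pos_nonneg)
      finally show ?thesis
        using s0[of k] by simp
    qed
    have "s \<longlonglongrightarrow> 0"
      unfolding s_def by (rule LIMSEQ_Suc[OF lim_const_over_n])
    then have s: "filterlim s (at 0) sequentially"
      using s0 by (auto simp: filterlim_at less_imp_neq[symmetric])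
    have lim: "(\<lambda>k. (1 / s k) *\<^sub>R (G (p + s k *\<^sub>R h) t - G p t)) \<longlonglongrightarrow> G' t h" for t
      by (rule filterlim_compose[OF has_derivative_imp_scaled_difference[OF deriv] s])
    have bound: "norm ((1 / s k) *\<^sub>R (G (p + s k *\<^sub>R h) t - G p t)) \<le> L t * norm h" for k t
      using lip[OF s1[of k], of t] s0[of k] by (simp add: pos_divide_le_eq mult_ac)
    have meas: "(\<lambda>t. (1 / s k) *\<^sub>R (G (p + s k *\<^sub>R h) t - G p t)) \<in> borel_measurable M" for k
      using int[OF s1[of k]] intp by measurable
    \<comment> \<open>Nothing is assumed about how \<open>G'\<close> depends on t; measurability and
      the bound by L both pass to the limit of difference quotients.\<close>
    have "(\<lambda>t. G' t h) \<in> borel_measurable M"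
      using meas lim by (rule borel_measurable_LIMSEQ_metric)
    then have "integrable M (\<lambda>t. G' t h)"
      using meas L lim bound
      by (intro integrable_dominated_convergence[where w = "\<lambda>t. L t * norm h"
            and s = "\<lambda>k t. (1 / s k) *\<^sub>R (G (p + s k *\<^sub>R h) t - G p t)"]) auto
    moreover have "norm (G' t h) \<le> L t * norm h" for t
      by (rule LIMSEQ_le_const2[OF tendsto_norm[OF lim]]) (use bound in auto)
    ultimately show ?thesis by blast
  qed
  then show int': "integrable M (\<lambda>t. G' t h)" for h by blast
  have G'L: "norm (G' t h) \<le> L t * norm h" for t h
    using both by blast
  have lin: "linear (G' t)" for t
    using deriv has_derivative_linear by blast
  show "((\<lambda>q. \<integral>t. G q t \<partial>M) has_derivative (\<lambda>h. \<integral>t. G' t h \<partial>M)) (at p)"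
    unfolding has_derivative_at
  proof
    show "bounded_linear (\<lambda>h. \<integral>t. G' t h \<partial>M)"
    proof (rule bounded_linear_intro)
      show "(\<integral>t. G' t (x + y) \<partial>M) = (\<integral>t. G' t x \<partial>M) + (\<integral>t. G' t y \<partial>M)" for x y
        using int' by (simp add: linear_add[OF lin])
      show "(\<integral>t. G' t (c *\<^sub>R x) \<partial>M) = c *\<^sub>R (\<integral>t. G' t x \<partial>M)" for c x
        by (simp add: linear_scale[OF lin])
      show "norm (\<integral>t. G' t h \<partial>M) \<le> norm h * (\<integral>t. L t \<partial>M)" for h
      proof -
        have "norm (\<integral>t. G' t h \<partial>M) \<le> (\<integral>t. norm (G' t h) \<partial>M)"
          by (rule integral_norm_bound)
        also have "\<dots> \<le> (\<integral>t. L t * norm h \<partial>M)"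
          using G'L int' L by (intro integral_mono integrable_norm) auto
        finally have "norm (\<integral>t. G' t h \<partial>M) \<le> (\<integral>t. L t * norm h \<partial>M)" .
        then show ?thesis by (simp add: mult.commute)
      qed
    qed
    \<comment> \<open>The remainder quotient: it tends to 0 pointwise, and its two parts are each at
      most L(t).\<close>
    define Q where "Q = (\<lambda>h t. (1 / norm h) *\<^sub>R (G (p + h) t - G p t - G' t h))"
    have "((\<lambda>h. \<integral>t. Q h t \<partial>M) \<longlongrightarrow> 0) (at 0)"
      unfolding tendsto_at_iff_sequentially comp_def
    proof (intro allI impI)
      fix X :: "nat \<Rightarrow> 'a"
      assume X0: "\<forall>i. X i \<in> UNIV - {0}" and X: "X \<longlonglongrightarrow> 0"
      then have "eventually (\<lambda>i. norm (X i) < e) sequentially"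
        using e tendstoD[OF X e] by (simp add: dist_norm)
      \<comment> \<open>The Lipschitz bound holds only for |h| < e, so the sequence is shifted until
        it stays in that ball.\<close>
      then obtain N where N: "\<And>i. norm (X (i + N)) < e"
        unfolding eventually_sequentially by (metis le_add2)
      have "(\<lambda>i. \<integral>t. Q (X (i + N)) t \<partial>M) \<longlonglongrightarrow> (\<integral>t. 0 \<partial>M)"
      proof (rule integral_dominated_convergence[where w = "\<lambda>t. 2 * L t"])
        show "Q (X (i + N)) \<in> borel_measurable M" for i
          unfolding Q_def using int[OF N[of i]] intp int'[of "X (i + N)"] by measurable
        show "AE t in M. norm (Q (X (i + N)) t) \<le> 2 * L t" for i
        proof (intro always_eventually allI)
          fix t
          have "norm (G (p + X (i + N)) t - G p t - G' t (X (i + N)))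
              \<le> L t * norm (X (i + N)) + L t * norm (X (i + N))"
            using lip[OF N[of i], of t] G'L[of t "X (i + N)"]
            by (meson order.trans[OF norm_triangle_ineq4] add_mono)
          then show "norm (Q (X (i + N)) t) \<le> 2 * L t"
            using X0 by (simp add: Q_def pos_divide_le_eq mult.assoc)
        qed
        show "AE t in M. (\<lambda>i. Q (X (i + N)) t) \<longlonglongrightarrow> 0"
        proof (intro always_eventually allI)
          fix t
          have "((\<lambda>h. norm (Q h t)) \<longlongrightarrow> 0) (at 0)"
            using deriv[of t] by (simp add: has_derivative_at Q_def)
          then have "((\<lambda>h. Q h t) \<longlongrightarrow> 0) (at 0)"
            by (rule tendsto_norm_zero_cancel)
          then have "(\<lambda>i. Q (X i) t) \<longlonglongrightarrow> 0"
            using X0 X unfolding tendsto_at_iff_sequentially comp_def by blast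
          then show "(\<lambda>i. Q (X (i + N)) t) \<longlonglongrightarrow> 0"
            by (rule LIMSEQ_ignore_initial_segment)
        qed
      qed (use L in auto)
      then show "(\<lambda>i. \<integral>t. Q (X i) t \<partial>M) \<longlonglongrightarrow> 0"
        by (simp add: LIMSEQ_offset)
    qed
    then have "((\<lambda>h. norm (\<integral>t. Q h t \<partial>M)) \<longlongrightarrow> 0) (at 0)"
      by (rule tendsto_norm_zero)
    moreover have "eventually (\<lambda>h. norm (\<integral>t. Q h t \<partial>M) =
        norm ((\<integral>t. G (p + h) t \<partial>M) - (\<integral>t. G p t \<partial>M) - (\<integral>t. G' t h \<partial>M)) / norm h) (at 0)"
      unfolding eventually_at
    proof (intro exI[of _ e] conjI ballI impI e)
      fix h :: 'a
      assume "h \<noteq> 0 \<and> dist h 0 < e"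
      then have "(\<integral>t. Q h t \<partial>M) =
          (1 / norm h) *\<^sub>R ((\<integral>t. G (p + h) t \<partial>M) - (\<integral>t. G p t \<partial>M) - (\<integral>t. G' t h \<partial>M))"
        using int[of h] intp int'[of h] by (simp add: Q_def)
      then show "norm (\<integral>t. Q h t \<partial>M) =
        norm ((\<integral>t. G (p + h) t \<partial>M) - (\<integral>t. G p t \<partial>M) - (\<integral>t. G' t h \<partial>M)) / norm h"
        by simp
    qed
    ultimately show "(\<lambda>h. norm ((\<integral>t. G (p + h) t \<partial>M) - (\<integral>t. G p t \<partial>M) - (\<integral>t. G' t h \<partial>M)) / norm h)
        \<midarrow>0\<rightarrow> 0"
      by (simp cong: tendsto_cong)
  qed
qed

text \<open>Off a null set N the function is continuous on the set -N, hence measurable there;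
  completeness of Lebesgue measure allows arbitrary values on N.\<close>

lemma borel_measurable_AE_isCont:
  fixes f :: "'a::euclidean_space \<Rightarrow> 'b::euclidean_space"
  assumes "AE t in lebesgue. isCont f t"
  shows "f \<in> borel_measurable lebesgue"
proof -
  obtain N where N: "N \<in> null_sets lebesgue" "\<And>t. t \<notin> N \<Longrightarrow> isCont f t"
    using assms unfolding completion.AE_iff_null_sets by auto
  have S: "- N \<in> sets lebesgue"
    using N(1) by (simp add: Compl_in_sets_lebesgue null_setsD2)
  have "continuous_on (- N) f"
    using N(2) by (intro continuous_at_imp_continuous_on) auto
  then have "f \<in> borel_measurable (lebesgue_on (- N))"
    using S by (rule continuous_imp_measurable_on_sets_lebesgue)
  then have "(\<lambda>t. if t \<in> - N then f t else 0) \<in> borel_measurable lebesgue"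
    using borel_measurable_if[OF S] by blast
  then show ?thesis
    by (rule borel_measurable_AE) (rule eventually_mono[OF AE_not_in[OF N(1)]], simp)
qed

section \<open>Exponentially decaying transforms\<close>

text \<open>\<open>E = exp \<circ> (- V)\<close>, where \<open>V = id\<close> for the kernel (C) and \<open>V\<close> is \<open>sph\<close> below for
  (S).\<close>

locale kernel_exp =
  fixes E :: "'r cd \<Rightarrow> 'r cd" and C :: real
  assumes norm_E_le: "norm (E x) \<le> C * exp (- cd_Re x)"
    and ex_deriv_E: "\<exists>D. (E has_derivative D) (at x) \<and>
      (\<forall>h. norm (D h) \<le> C * (1 + norm x) * exp (- cd_Re x) * norm h)"
    and E_add_real: "E (x + c *\<^sub>R 1) = exp (- c) *\<^sub>R E x"
begin

abbreviation E' :: "'r cd \<Rightarrow> 'r cd \<Rightarrow> 'r cd" where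
  "E' x \<equiv> frechet_derivative E (at x)"

lemma deriv_E: "(E has_derivative E' x) (at x)"
  using ex_deriv_E[of x] frechet_derivative_works differentiableI by blast

lemma norm_E'_le: "norm (E' x h) \<le> C * (1 + norm x) * exp (- cd_Re x) * norm h"
  using ex_deriv_E[of x] frechet_derivative_at by metis

lemma C_nonneg: "0 \<le> C"
  using order.trans[OF norm_ge_zero norm_E_le[of 0]] by (simp add: cd_Re_def)

lemma continuous_on_E: "continuous_on A E"
  using deriv_E by (intro continuous_at_imp_continuous_on ballI has_derivative_continuous)

text \<open>Differentiate E(x + s) = exp(-s) E(x) at s = 0. This is why the h_0 term of the formula
  carries no operator S.\<close>

lemma E'_one: "E' x 1 = - E x"
proof -
  have "((\<lambda>s::real. E (x + s *\<^sub>R 1)) has_derivative (\<lambda>s. E' x (s *\<^sub>R 1))) (at 0)"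
    by (rule has_derivative_compose[where g = E and f = "\<lambda>s. x + s *\<^sub>R 1"])
      (auto intro!: derivative_eq_intros deriv_E)
  moreover have "((\<lambda>s::real. E (x + s *\<^sub>R 1)) has_derivative (\<lambda>s. s *\<^sub>R (- E x))) (at 0)"
    unfolding E_add_real by (auto intro!: derivative_eq_intros)
  ultimately have "(\<lambda>s::real. E' x (s *\<^sub>R 1)) = (\<lambda>s. s *\<^sub>R (- E x))"
    by (rule has_derivative_unique)
  from fun_cong[OF this, of 1] show ?thesis by simp
qed

text \<open>Mean value inequality on the ball of radius \<rho> about x, where the norm rises and the
  real part falls by at most \<rho>.\<close>

lemma norm_E_diff_le:
  assumes "norm k \<le> \<rho>"
  shows "norm (E (x + k) - E x) \<le> C * (1 + norm x + \<rho>) * exp (- cd_Re x + \<rho>) * norm k"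
proof -
  have "norm (E (x + k) - E x) \<le> (C * (1 + norm x + \<rho>) * exp (- cd_Re x + \<rho>)) * norm (x + k - x)"
  proof (rule differentiable_bound[where S = "cball x \<rho>" and f' = E'])
    fix y assume "y \<in> cball x \<rho>"
    then have y: "norm (y - x) \<le> \<rho>"
      by (simp add: dist_norm norm_minus_commute)
    then have "norm y \<le> norm x + \<rho>"
      using norm_triangle_ineq[of x "y - x"] by simp
    moreover have "- cd_Re y \<le> - cd_Re x + \<rho>"
      using cd_Re_le_norm[of "y - x"] y by (simp add: cd_Re_def)
    ultimately have "C * (1 + norm y) * exp (- cd_Re y) \<le> C * (1 + norm x + \<rho>) * exp (- cd_Re x + \<rho>)"
      using C_nonneg order.trans[OF norm_ge_zero assms] by (intro mult_mono) auto
    then have "norm (E' y h) \<le> (C * (1 + norm x + \<rho>) * exp (- cd_Re x + \<rho>)) * norm h" for h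
      using norm_E'_le[of y h] by (meson mult_right_mono norm_ge_zero order.trans)
    then show "onorm (E' y) \<le> C * (1 + norm x + \<rho>) * exp (- cd_Re x + \<rho>)"
      by (intro onorm_le)
  qed (use assms order.trans[OF norm_ge_zero assms] in
      \<open>auto intro: has_derivative_at_withinI deriv_E simp: dist_norm\<close>)
  then show ?thesis by simp
qed

text \<open>The analytic core. The parameter space is left general because it is the algebra when p
  varies and the real line when a single \<zeta>_k varies. The decay comes from f and x alone; g, x
  and M may each grow linearly in t.\<close>

lemma has_derivative_transform:
  fixes f :: "real ^ 'n \<Rightarrow> 'r cd" and g :: "real ^ 'n \<Rightarrow> real" and x :: "real ^ 'n \<Rightarrow> 'r cd"
    and M :: "real ^ 'n \<Rightarrow> 'a::real_normed_vector \<Rightarrow> 'r cd" and p :: 'a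
  assumes f: "f \<in> borel_measurable lebesgue" and g: "g \<in> borel_measurable lebesgue"
    and x: "x \<in> borel_measurable lebesgue" and M: "\<And>h. (\<lambda>t. M t h) \<in> borel_measurable lebesgue"
    and lin: "\<And>t. bounded_linear (M t)"
    and d: "0 < d" and B: "0 \<le> B"
    and fx: "\<And>t. norm (f t) * exp (- cd_Re (x t)) \<le> A * exp (- d * abs_sum t)"
    and gB: "\<And>t. \<bar>g t\<bar> \<le> B * (1 + abs_sum t)" and xB: "\<And>t. norm (x t) \<le> B * (1 + abs_sum t)"
    and MB: "\<And>t h. norm (M t h) \<le> B * (1 + abs_sum t) * norm h"
  shows "integrable lebesgue (\<lambda>t. (g t *\<^sub>R f t) * E (x t))" (is ?I)
    and "integrable lebesgue (\<lambda>t. (g t *\<^sub>R f t) * E' (x t) (M t h))"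
    and "((\<lambda>q. \<integral>t. (g t *\<^sub>R f t) * E (x t + M t (q - p)) \<partial>lebesgue) has_derivative
      (\<lambda>h. \<integral>t. (g t *\<^sub>R f t) * E' (x t) (M t h) \<partial>lebesgue)) (at p)"
proof -
  note [measurable] = f g x M
  obtain K where K: "0 \<le> K" "\<And>z w :: 'r cd. norm (z * w) \<le> norm z * norm w * K"
    using cd_mult.nonneg_bounded by blast
  have A: "0 \<le> A"
  proof -
    have "0 \<le> A * exp (- d * abs_sum (0 :: real ^ 'n))"
      by (rule order.trans[OF _ fx]) simp
    then show ?thesis by (simp add: zero_le_mult_iff)
  qed
  have meas: "(\<lambda>t. (g t *\<^sub>R f t) * E (y t)) \<in> borel_measurable lebesgue"
    if [measurable]: "y \<in> borel_measurable lebesgue" for y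
  proof -
    have [measurable]: "(\<lambda>t. E (y t)) \<in> borel_measurable lebesgue"
      using borel_measurable_continuous_onI[OF continuous_on_E] that by (rule measurable_compose[rotated])
    show ?thesis
      by (rule borel_measurable_continuous_Pair[OF _ _ cd_mult.continuous_on])
        (auto intro!: continuous_intros)
  qed
  have gf: "\<bar>g t\<bar> * (norm (f t) * exp (- cd_Re (x t))) \<le> B * (1 + abs_sum t) * (A * exp (- d * abs_sum t))" for t
    by (intro mult_mono gB fx) (use B in auto)
  have L0: "norm ((g t *\<^sub>R f t) * E (x t)) \<le> (K * B * A * C) * ((1 + abs_sum t) ^ 1 * exp (- d * abs_sum t))" for t
  proof -
    have "norm ((g t *\<^sub>R f t) * E (x t)) \<le> norm (g t *\<^sub>R f t) * norm (E (x t)) * K"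
      by (rule K)
    also have "\<dots> \<le> norm (g t *\<^sub>R f t) * (C * exp (- cd_Re (x t))) * K"
      by (intro mult_mono norm_E_le) (use K C_nonneg in auto)
    also have "\<dots> = (\<bar>g t\<bar> * (norm (f t) * exp (- cd_Re (x t)))) * (C * K)"
      by simp
    also have "\<dots> \<le> (B * (1 + abs_sum t) * (A * exp (- d * abs_sum t))) * (C * K)"
      by (intro mult_right_mono gf) (use K C_nonneg in auto)
    finally show ?thesis by (simp add: mult_ac)
  qed
  show I: ?I
    by (rule Bochner_Integration.integrable_bound[OF integrable_mult_right[OF
          integrable_power_mult_exp_abs_sum[OF d, of 1], of "K * B * A * C"] meas[OF x]])
      (intro always_eventually allI order.trans[OF L0], simp add: order.trans[OF _ abs_ge_self])
  \<comment> \<open>For |h| < e the perturbation M h has norm at most B e (1 + |t|), which costs the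
    exponent a constant and at most half of the rate d.\<close>
  define e where "e = d / (2 * (B + 1))"
  have e: "0 < e" and Be: "B * e \<le> d / 2"
    using d B by (auto simp: e_def field_simps)
  define c where "c = K * B * A * C * (1 + B + B * e) * exp (B * e) * B"
  \<comment> \<open>The third power is one factor 1 + |t| each from g, from 1 + |x| and from
    M.\<close>
  define L where "L = (\<lambda>t :: real ^ 'n. c * ((1 + abs_sum t) ^ 3 * exp (- (d / 2) * abs_sum t)))"
  have L: "integrable lebesgue L"
    unfolding L_def using d by (intro integrable_mult_right integrable_power_mult_exp_abs_sum) auto
  have lip: "norm ((g t *\<^sub>R f t) * E (x t + M t h) - (g t *\<^sub>R f t) * E (x t)) \<le> L t * norm h"
    if h: "norm h < e" for t h
  proof -
    define S where "S = 1 + abs_sum t"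
    have S: "1 \<le> S" by (simp add: S_def)
    have "norm (M t h) \<le> B * S * e"
      using MB[of t h] h B S by (smt (verit) S_def mult_left_mono mult_nonneg_nonneg)
    from norm_E_diff_le[OF this, of "x t"]
    have "norm (E (x t + M t h) - E (x t)) \<le>
        C * (1 + norm (x t) + B * S * e) * exp (- cd_Re (x t) + B * S * e) * norm (M t h)" .
    also have "\<dots> \<le> C * (S * (1 + B + B * e)) * (exp (- cd_Re (x t)) * (exp (B * e) * exp (d / 2 * abs_sum t)))
        * (B * S * norm h)"
    proof (intro mult_mono order.refl)
      show "1 + norm (x t) + B * S * e \<le> S * (1 + B + B * e)"
        using xB[of t] S by (simp add: S_def[symmetric] algebra_simps)
      have "B * S * e \<le> B * e + d / 2 * abs_sum t"
        using mult_right_mono[OF Be abs_sum_nonneg[of t]] by (simp add: S_def algebra_simps)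
      then show "exp (- cd_Re (x t) + B * S * e) \<le>
          exp (- cd_Re (x t)) * (exp (B * e) * exp (d / 2 * abs_sum t))"
        by (simp add: exp_add[symmetric] mult.assoc)
      show "norm (M t h) \<le> B * S * norm h"
        using MB[of t h] by (simp add: S_def)
    qed (use C_nonneg B S e in auto)
    finally have E: "norm (E (x t + M t h) - E (x t)) \<le> \<dots>" .
    have "norm ((g t *\<^sub>R f t) * E (x t + M t h) - (g t *\<^sub>R f t) * E (x t)) \<le>
        norm (g t *\<^sub>R f t) * norm (E (x t + M t h) - E (x t)) * K"
      unfolding cd_mult.diff_right[symmetric] by (rule K)
    also have "\<dots> \<le> norm (g t *\<^sub>R f t) * (C * (S * (1 + B + B * e)) *
        (exp (- cd_Re (x t)) * (exp (B * e) * exp (d / 2 * abs_sum t))) * (B * S * norm h)) * K"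
      by (intro mult_mono E order.refl) (use K C_nonneg B S e in auto)
    also have "\<dots> = (\<bar>g t\<bar> * (norm (f t) * exp (- cd_Re (x t)))) * (C * (S * (1 + B + B * e)) *
        (exp (B * e) * exp (d / 2 * abs_sum t)) * (B * S * norm h) * K)"
      by (simp add: mult_ac)
    also have "\<dots> \<le> (B * S * (A * exp (- d * abs_sum t))) * (C * (S * (1 + B + B * e)) *
        (exp (B * e) * exp (d / 2 * abs_sum t)) * (B * S * norm h) * K)"
      unfolding S_def by (intro mult_right_mono gf mult_nonneg_nonneg)
        (use K C_nonneg B S e in auto)
    also have "\<dots> = c * (S ^ 3 * (exp (- d * abs_sum t) * exp (d / 2 * abs_sum t))) * norm h"
      by (simp add: c_def power3_eq_cube mult_ac)
    also have "exp (- d * abs_sum t) * exp (d / 2 * abs_sum t) = exp (- (d / 2) * abs_sum t)"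
      by (simp add: exp_add[symmetric])
    finally show ?thesis by (simp add: L_def S_def)
  qed
  have M0: "M t 0 = 0" for t
    using lin[of t] by (rule linear_simps(3))
  define G where "G = (\<lambda>q t. (g t *\<^sub>R f t) * E (x t + M t (q - p)))"
  have int: "integrable lebesgue (G (p + h))" if "norm h < e" for h
  proof -
    have "(\<lambda>t. (g t *\<^sub>R f t) * E (x t + M t h)) \<in> borel_measurable lebesgue"
      by (rule meas) measurable
    moreover have "(\<lambda>t. (g t *\<^sub>R f t) * E (x t)) \<in> borel_measurable lebesgue"
      by (rule meas) measurable
    \<comment> \<open>At p + h integrability follows from that at p, since the difference is
      dominated by L |h|.\<close>
    ultimately have "integrable lebesgue (\<lambda>t. (g t *\<^sub>R f t) * E (x t + M t h) - (g t *\<^sub>R f t) * E (x t))"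
      by (intro Bochner_Integration.integrable_bound[OF integrable_mult_left[OF L, of "norm h"]])
        (auto intro!: order.trans[OF lip[OF that]])
    from Bochner_Integration.integrable_add[OF this I] show ?thesis
      by (simp add: G_def)
  qed
  have deriv: "((\<lambda>q. G q t) has_derivative (\<lambda>h. (g t *\<^sub>R f t) * E' (x t) (M t h))) (at p)" for t
  proof -
    have "((\<lambda>q. q - p) has_derivative (\<lambda>h. h)) (at p)"
      by (auto intro!: derivative_eq_intros)
    from has_derivative_add[OF has_derivative_const bounded_linear.has_derivative[OF lin this]]
    have "((\<lambda>q. x t + M t (q - p)) has_derivative M t) (at p)"
      by simp
    moreover have "(E has_derivative E' (x t)) (at (x t + M t (p - p)))"
      using deriv_E by (simp add: M0)
    ultimately have "((\<lambda>q. E (x t + M t (q - p))) has_derivative (\<lambda>h. E' (x t) (M t h))) (at p)"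
      by (rule has_derivative_compose)
    then show ?thesis
      unfolding G_def by (rule bounded_linear.has_derivative[OF cd_mult.bounded_linear_right])
  qed
  have lip': "norm (G (p + h) t - G p t) \<le> L t * norm h" if "norm h < e" for t h
    using lip[OF that] by (simp add: G_def M0)
  show "integrable lebesgue (\<lambda>t. (g t *\<^sub>R f t) * E' (x t) (M t h))"
    by (rule has_derivative_integral_dominated(1)[OF e int deriv lip' L])
  show "((\<lambda>q. \<integral>t. (g t *\<^sub>R f t) * E (x t + M t (q - p)) \<partial>lebesgue) has_derivative
      (\<lambda>h. \<integral>t. (g t *\<^sub>R f t) * E' (x t) (M t h) \<partial>lebesgue)) (at p)"
    using has_derivative_integral_dominated(2)[OF e int deriv lip' L] by (simp add: G_def)
qed

end

section \<open>Growth of the coefficients and decay of originals\<close>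

lemma tsum_1_eq: "tsum (t :: real ^ 'n::{finite,linorder}) 1 = (\<Sum>i\<in>UNIV. t $ i)"
proof -
  let ?l = "sorted_list_of_set (UNIV :: 'n set)"
  have "tsum t 1 = (\<Sum>m = 1..CARD('n). t $ (?l ! (m - 1)))"
    by (simp add: tsum_def tc_def)
  also have "\<dots> = (\<Sum>m<CARD('n). t $ (?l ! m))"
    by (rule sum.reindex_bij_witness[of _ Suc "\<lambda>m. m - 1"]) auto
  also have "\<dots> = (\<Sum>i\<leftarrow>?l. t $ i)"
    by (simp add: sum_list_sum_nth lessThan_atLeast0)
  also have "\<dots> = (\<Sum>i\<in>UNIV. t $ i)"
    by (simp add: sum_list_distinct_conv_sum_set)
  finally show ?thesis .
qed

lemma abs_tc_le: "\<bar>tc t m\<bar> \<le> abs_sum (t :: real ^ 'n::{finite,linorder})"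
  unfolding tc_def abs_sum_def
  by (auto intro!: member_le_sum[where f = "\<lambda>i. \<bar>t $ i\<bar>"] sum_nonneg)

lemma continuous_on_tc:
  fixes A :: "(real ^ 'n::{finite,linorder}) set"
  shows "continuous_on A (\<lambda>t. tc t m)"
proof (cases "1 \<le> m \<and> m \<le> CARD('n)")
  case True
  then show ?thesis
    unfolding tc_def by (simp add: continuous_intros)
next
  case False
  then have "tc t m = 0" if "t \<in> A" for t
    by (auto simp: tc_def)
  then show ?thesis
    by (intro continuous_on_eq[OF continuous_on_const[of A 0]]) simp
qed

lemma abs_tsum_le: "\<bar>tsum t m\<bar> \<le> real CARD('n) * abs_sum (t :: real ^ 'n::{finite,linorder})"
proof (cases "m = 0")
  case True
  \<comment> \<open>The sum from index 0 has n + 1 terms, but the extra one vanishes.\<close>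
  have "tsum t 0 = tsum t 1"
    unfolding tsum_def by (rule sum.mono_neutral_right) (auto simp: tc_def)
  then have "\<bar>tsum t m\<bar> \<le> 1 * abs_sum t"
    using True by (simp add: tsum_1_eq abs_sum_def del: One_nat_def)
  also have "\<dots> \<le> real CARD('n) * abs_sum t"
    by (intro mult_right_mono) (auto simp: Suc_leI)
  finally show ?thesis .
next
  case False
  have "\<bar>tsum t m\<bar> \<le> (\<Sum>k = m..CARD('n). abs_sum t)"
    unfolding tsum_def by (rule order.trans[OF sum_abs sum_mono]) (rule abs_tc_le)
  also have "\<dots> \<le> real CARD('n) * abs_sum t"
    using False by (auto intro!: mult_right_mono)
  finally show ?thesis .
qed

lemma continuous_on_tsum: "continuous_on A (\<lambda>t. tsum t m)"
  unfolding tsum_def by (intro continuous_intros continuous_on_tc)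

lemma original_borel_measurable: "original a f \<Longrightarrow> f \<in> borel_measurable lebesgue"
  unfolding original_def by (intro borel_measurable_AE_isCont) blast

text \<open>On an orthant the exponent is the sum of (a(v_j) - Re p) t_j. The strip makes the
  bracket at most -d where t_j \<ge> 0 and at least d where t_j < 0, so each summand is at most -d
  |t_j|.\<close>

lemma original_growth:
  fixes f :: "real ^ 'n::{finite,linorder} \<Rightarrow> 'r cd"
  assumes f: "original a f" and p: "p \<in> strip a"
  obtains A d where "0 < d"
    "\<And>t. norm (f t) * exp (- (cd_Re p * tsum t 1)) \<le> A * exp (- d * abs_sum t)"
proof -
  \<comment> \<open>Orthants are indexed by their sets of nonnegative coordinates: finitely many, so
    the sum of all C_J is a constant valid everywhere.\<close>
  define v where "v = (\<lambda>(J :: 'n set) i. if i \<in> J then 1 else (- 1 :: int))"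
  have "\<exists>C > 0. \<forall>t. (\<forall>j. of_int (v J j) * t $ j \<ge> 0) \<longrightarrow>
        norm (f t) < C * exp (\<Sum>j\<in>UNIV. a (v J j) * t $ j)" for J
  proof -
    have "range (v J) \<subseteq> {-1, 1}"
      by (auto simp: v_def)
    then show ?thesis
      using f unfolding original_def by blast
  qed
  then obtain C where C: "\<And>J. 0 < C J" "\<And>J t. (\<And>j. of_int (v J j) * t $ j \<ge> 0) \<Longrightarrow>
        norm (f t) < C J * exp (\<Sum>j\<in>UNIV. a (v J j) * t $ j)"
    by metis
  define d where "d = min (cd_Re p - a 1) (a (- 1) - cd_Re p)"
  have d: "0 < d"
    using p by (simp add: d_def strip_def)
  have "norm (f t) * exp (- (cd_Re p * tsum t 1)) \<le> (\<Sum>J\<in>UNIV. C J) * exp (- d * abs_sum t)" for t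
  proof -
    define J where "J = {j. 0 \<le> t $ j}"
    have "norm (f t) * exp (- (cd_Re p * tsum t 1)) \<le>
        C J * exp (\<Sum>j\<in>UNIV. a (v J j) * t $ j) * exp (- (cd_Re p * tsum t 1))"
      by (intro mult_right_mono less_imp_le[OF C(2)]) (auto simp: v_def J_def)
    also have "\<dots> = C J * exp (\<Sum>j\<in>UNIV. (a (v J j) - cd_Re p) * t $ j)"
      unfolding tsum_1_eq
      by (simp add: mult.assoc exp_add[symmetric] sum_distrib_left sum_subtractf algebra_simps)
    also have "\<dots> \<le> (\<Sum>J\<in>UNIV. C J) * exp (- d * abs_sum t)"
    proof (intro mult_mono)
      show "C J \<le> (\<Sum>J\<in>UNIV. C J)"
        using C(1) by (intro member_le_sum) (auto intro: less_imp_le)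
      have "(a (v J j) - cd_Re p) * t $ j \<le> - d * \<bar>t $ j\<bar>" for j
      proof (cases "0 \<le> t $ j")
        case True
        then show ?thesis
          using mult_right_mono[of d "cd_Re p - a 1" "t $ j"]
          by (simp add: v_def J_def d_def algebra_simps)
      next
        case False
        then show ?thesis
          using mult_right_mono[of d "a (- 1) - cd_Re p" "- t $ j"]
          by (simp add: v_def J_def d_def algebra_simps)
      qed
      then show "exp (\<Sum>j\<in>UNIV. (a (v J j) - cd_Re p) * t $ j) \<le> exp (- d * abs_sum t)"
        by (simp add: abs_sum_def sum_distrib_left sum_negf[symmetric] sum_mono)
    qed (use C(1) in \<open>auto intro!: sum_nonneg simp: less_imp_le\<close>)
    finally show ?thesis .
  qed
  with d that show ?thesis by blast
qed

section \<open>Diagonal maps of the algebra\<close>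

lemma cd_coord_sum_unit:
  assumes "finite A" and "m < 2 ^ CARD('r)"
  shows "cd_coord (\<Sum>j\<in>A. c j *\<^sub>R (cd_unit j :: 'r cd)) m = (if m \<in> A then c m else 0)"
proof -
  have "cd_coord (\<Sum>j\<in>A. c j *\<^sub>R (cd_unit j :: 'r cd)) m = (\<Sum>j\<in>A. if m = j then c j else 0)"
    using assms(2) by (auto intro!: sum.cong)
  then show ?thesis
    using assms(1) by simp
qed

text \<open>The map T with diagonal \<tau>. Cutting off above n builds in the convention p_m = 0 for
  m > n.\<close>

definition cd_diag :: "nat \<Rightarrow> (nat \<Rightarrow> real) \<Rightarrow> 'r cd \<Rightarrow> 'r cd" where
  "cd_diag n \<tau> q = cd_of (\<lambda>m. if m \<le> n then \<tau> m * cd_coord q m else 0)"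

lemma norm_cd_le_sum: "norm (z :: 'r cd) \<le> (\<Sum>m<2 ^ CARD('r). \<bar>cd_coord z m\<bar>)"
proof -
  have inj: "inj_on (cd_unit :: nat \<Rightarrow> 'r cd) {..<2 ^ CARD('r)}"
  proof (rule inj_onI)
    fix j k assume "j \<in> {..<2 ^ CARD('r)}" "k \<in> {..<2 ^ CARD('r)}" "cd_unit j = (cd_unit k :: 'r cd)"
    then have "cd_coord (cd_unit j :: 'r cd) j = cd_coord (cd_unit k :: 'r cd) j" "j < 2 ^ CARD('r)"
      by auto
    then show "j = k" by (auto split: if_splits)
  qed
  show ?thesis
    using norm_le_l1[of z] unfolding Basis_cd_def sum.reindex[OF inj] by (simp add: inner_cd_unit)
qed

lemma bounded_linear_cd_diag: "bounded_linear (cd_diag n \<tau> :: 'r cd \<Rightarrow> 'r cd)"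
  by (rule linear_conv_bounded_linear[THEN iffD1], rule linearI)
    (auto intro!: cd_eqI simp: cd_diag_def algebra_simps)

lemma norm_cd_diag_le:
  assumes "\<And>m. m \<le> n \<Longrightarrow> \<bar>\<tau> m\<bar> \<le> c" and "0 \<le> c"
  shows "norm (cd_diag n \<tau> q :: 'r cd) \<le> 2 ^ CARD('r) * c * norm q"
proof -
  have "norm (cd_diag n \<tau> q) \<le> (\<Sum>m<2 ^ CARD('r). \<bar>cd_coord (cd_diag n \<tau> q) m\<bar>)"
    by (rule norm_cd_le_sum)
  also have "\<dots> \<le> (\<Sum>m<(2::nat) ^ CARD('r). c * norm q)"
    using assms by (intro sum_mono) (auto simp: cd_diag_def abs_mult intro!: mult_mono abs_cd_coord_le)
  finally show ?thesis by simp
qed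

lemma borel_measurable_cd_diag:
  assumes "\<And>m. continuous_on UNIV (\<lambda>t. \<tau> t m)"
  shows "(\<lambda>t. cd_diag n (\<tau> t) q :: 'r cd) \<in> borel_measurable lebesgue"
proof -
  have "cd_diag n \<tau> q = (\<Sum>m\<in>{..n}. (\<tau> m * cd_coord q m) *\<^sub>R (cd_unit m :: 'r cd))" for \<tau>
    by (rule cd_eqI) (simp add: cd_coord_sum_unit cd_diag_def del: cd_coord_sum)
  then show ?thesis
    by (auto intro!: continuous_imp_borel_measurable_lebesgue continuous_intros assms)
qed

section \<open>The two kernels\<close>

definition bdd_C1 :: "('a::real_normed_vector \<Rightarrow> 'b::real_normed_vector) \<Rightarrow> bool" where
  "bdd_C1 g \<longleftrightarrow> (\<exists>c\<ge>0. \<forall>x. norm (g x) \<le> c \<and>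
    (\<exists>D. (g has_derivative D) (at x) \<and> (\<forall>h. norm (D h) \<le> c * norm h)))"

lemma bdd_C1I:
  assumes "\<And>x. norm (g x) \<le> c" and "\<And>x. (g has_derivative D x) (at x)"
    and "\<And>x h. norm (D x h) \<le> c' * norm h"
  shows "bdd_C1 g"
proof -
  have "0 \<le> c"
    using order.trans[OF norm_ge_zero assms(1)] .
  moreover have "norm (D x h) \<le> max c c' * norm h" for x h
    using assms(3)[of x h] by (smt (verit) max.cobounded2 mult_right_mono norm_ge_zero)
  moreover have "norm (g x) \<le> max c c'" for x
    using assms(1)[of x] by simp
  moreover have "0 \<le> max c c'"
    using \<open>0 \<le> c\<close> by simp
  ultimately show ?thesis
    unfolding bdd_C1_def using assms(2) by blast
qed

lemma bdd_C1E:
  assumes "bdd_C1 g"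
  obtains c D where "0 \<le> c" "\<And>x. norm (g x) \<le> c" "\<And>x. (g has_derivative D x) (at x)"
    "\<And>x h. norm (D x h) \<le> c * norm h"
proof -
  obtain c where c: "0 \<le> c" "\<And>x. norm (g x) \<le> c"
    "\<And>x. \<exists>D. (g has_derivative D) (at x) \<and> (\<forall>h. norm (D h) \<le> c * norm h)"
    using assms unfolding bdd_C1_def by blast
  from c(3) obtain D where "\<And>x. (g has_derivative D x) (at x) \<and> (\<forall>h. norm (D x h) \<le> c * norm h)"
    by metis
  with c that show ?thesis by blast
qed

lemma bdd_C1_const: "bdd_C1 (\<lambda>_. c)"
  by (rule bdd_C1I[of _ "norm c" "\<lambda>_ _. 0" 0]) auto

text \<open>In the product rule the size of each factor controls the derivative of the other, which
  is why \<open>bdd_C1\<close> bounds both. The spherical direction is then handled through its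
  sines and cosines alone.\<close>

lemma bdd_C1_scaleR:
  assumes "bdd_C1 f" and "bdd_C1 g"
  shows "bdd_C1 (\<lambda>x. f x *\<^sub>R g x)"
proof -
  obtain c D where f: "0 \<le> c" "\<And>x. norm (f x) \<le> c" "\<And>x. (f has_derivative D x) (at x)"
    "\<And>x h. norm (D x h) \<le> c * norm h"
    using bdd_C1E[OF assms(1)] by metis
  obtain c' D' where g: "0 \<le> c'" "\<And>x. norm (g x) \<le> c'" "\<And>x. (g has_derivative D' x) (at x)"
    "\<And>x h. norm (D' x h) \<le> c' * norm h"
    using bdd_C1E[OF assms(2)] by metis
  show ?thesis
  proof (rule bdd_C1I)
    show "norm (f x *\<^sub>R g x) \<le> c * c'" for x
      using f(1) f(2)[of x] g(2)[of x] by (simp add: mult_mono)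
    show "((\<lambda>x. f x *\<^sub>R g x) has_derivative (\<lambda>h. f x *\<^sub>R D' x h + D x h *\<^sub>R g x)) (at x)" for x
      by (intro has_derivative_scaleR f g)
    show "norm (f x *\<^sub>R D' x h + D x h *\<^sub>R g x) \<le> (c * c' + c * c') * norm h" for x h
    proof -
      have "norm (f x *\<^sub>R D' x h) \<le> c * (c' * norm h)"
        using f(1) f(2)[of x] g(4)[of x h] by (simp add: mult_mono)
      moreover have "norm (D x h *\<^sub>R g x) \<le> (c * norm h) * c'"
        using f(1) f(4)[of x h] g(2)[of x] by (simp add: mult_mono)
      ultimately show ?thesis
        by (intro norm_triangle_le) (simp add: algebra_simps)
    qed
  qed
qed

lemma bdd_C1_add:
  assumes "bdd_C1 f" and "bdd_C1 g"
  shows "bdd_C1 (\<lambda>x. f x + g x)"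
proof -
  obtain c D where f: "\<And>x. norm (f x) \<le> c" "\<And>x. (f has_derivative D x) (at x)"
    "\<And>x h. norm (D x h) \<le> c * norm h"
    using bdd_C1E[OF assms(1)] by metis
  obtain c' D' where g: "\<And>x. norm (g x) \<le> c'" "\<And>x. (g has_derivative D' x) (at x)"
    "\<And>x h. norm (D' x h) \<le> c' * norm h"
    using bdd_C1E[OF assms(2)] by metis
  show ?thesis
  proof (rule bdd_C1I)
    show "norm (f x + g x) \<le> c + c'" for x
      by (intro norm_triangle_le add_mono f g)
    show "((\<lambda>x. f x + g x) has_derivative (\<lambda>h. D x h + D' x h)) (at x)" for x
      by (intro has_derivative_add f g)
    show "norm (D x h + D' x h) \<le> (c + c') * norm h" for x h
      unfolding distrib_right by (intro norm_triangle_le add_mono f g)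
  qed
qed

lemma bdd_C1_sum:
  "(\<And>i. i \<in> I \<Longrightarrow> bdd_C1 (f i)) \<Longrightarrow> bdd_C1 (\<lambda>x. \<Sum>i\<in>I. f i x)"
  by (induction I rule: infinite_finite_induct) (auto intro: bdd_C1_const bdd_C1_add)

lemma bdd_C1_mult:
  fixes f g :: "'a::real_normed_vector \<Rightarrow> real"
  shows "bdd_C1 f \<Longrightarrow> bdd_C1 g \<Longrightarrow> bdd_C1 (\<lambda>x. f x * g x)"
  using bdd_C1_scaleR[of f g] by simp

lemma bdd_C1_prod:
  fixes f :: "'i \<Rightarrow> 'a::real_normed_vector \<Rightarrow> real"
  shows "(\<And>i. i \<in> I \<Longrightarrow> bdd_C1 (f i)) \<Longrightarrow> bdd_C1 (\<lambda>x. \<Prod>i\<in>I. f i x)"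
  by (induction I rule: infinite_finite_induct) (auto intro: bdd_C1_const bdd_C1_mult)

lemma bdd_C1_sin_cos_coord:
  "bdd_C1 (\<lambda>x :: 'r cd. sin (cd_coord x m))" "bdd_C1 (\<lambda>x :: 'r cd. cos (cd_coord x m))"
proof -
  have le: "\<bar>a * cd_coord h m\<bar> \<le> 1 * norm (h :: 'r cd)" if "\<bar>a\<bar> \<le> 1" for a h
    unfolding abs_mult using that by (intro mult_mono abs_cd_coord_le) auto
  note D = bounded_linear.has_derivative[OF bounded_linear_cd_coord has_derivative_ident]
  show "bdd_C1 (\<lambda>x :: 'r cd. sin (cd_coord x m))"
  proof (rule bdd_C1I[where c = 1 and c' = 1])
    show "((\<lambda>x :: 'r cd. sin (cd_coord x m)) has_derivative
        (\<lambda>h. cos (cd_coord x m) * cd_coord h m)) (at x)" for x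
      by (auto intro!: derivative_eq_intros D)
  qed (use le in auto)
  show "bdd_C1 (\<lambda>x :: 'r cd. cos (cd_coord x m))"
  proof (rule bdd_C1I[where c = 1 and c' = 1])
    show "((\<lambda>x :: 'r cd. cos (cd_coord x m)) has_derivative
        (\<lambda>h. - sin (cd_coord x m) * cd_coord h m)) (at x)" for x
      by (auto intro!: derivative_eq_intros D)
    show "norm (- sin (cd_coord x m) * cd_coord h m) \<le> 1 * norm h" for x h :: "'r cd"
      using le[of "- sin (cd_coord x m)"] by simp
  qed auto
qed

text \<open>With \<open>x = T\<^sub>t p + \<zeta>\<close>, the coordinates \<open>x\<^sub>1, x\<^sub>2, \<dots>\<close> are the angles \<open>\<phi>\<^sub>1, \<phi>\<^sub>2, \<dots>\<close> of the
  spherical kernel, and \<open>sph_dir x\<close> is \<open>M / \<phi>\<^sub>1\<close>.\<close>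

definition sph_dir :: "'r cd \<Rightarrow> 'r cd" where
  "sph_dir x = (let K = 2 ^ CARD('r) - 1 in
     (\<Sum>k = 1..K - 1. ((\<Prod>m = 2..k. sin (cd_coord x m)) * cos (cd_coord x (k + 1))) *\<^sub>R cd_unit k)
     + (\<Prod>m = 2..K. sin (cd_coord x m)) *\<^sub>R cd_unit K)"

definition sph :: "'r cd \<Rightarrow> 'r cd" where
  "sph x = cd_Re x *\<^sub>R 1 + cd_coord x 1 *\<^sub>R sph_dir x"

lemma bdd_C1_sph_dir: "bdd_C1 (sph_dir :: 'r cd \<Rightarrow> 'r cd)"
  unfolding sph_dir_def[abs_def] Let_def
  by (intro bdd_C1_add bdd_C1_sum bdd_C1_scaleR bdd_C1_mult bdd_C1_prod bdd_C1_const
      bdd_C1_sin_cos_coord)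

lemma cd_Re_sph:
  assumes "2 \<le> CARD('r)"
  shows "cd_Re (sph x :: 'r cd) = cd_Re x"
proof -
  have "(2::nat) ^ 1 < 2 ^ CARD('r)"
    using assms by (intro power_strict_increasing) auto
  then show ?thesis
    by (auto simp: sph_def sph_dir_def Let_def cd_Re_def)
qed

text \<open>A real summand changes only coordinate 0, while all angles have index at least
  1.\<close>

lemma sph_add_real: 
  assumes "2 \<le> CARD('r)"
  shows "sph (x + c *\<^sub>R 1) = sph x + c *\<^sub>R (1 :: 'r cd)"
proof -
  have K: "(2::nat) ^ 1 < 2 ^ CARD('r)"
    using assms by (intro power_strict_increasing) auto
  have "sph_dir (x + c *\<^sub>R 1) = sph_dir x"
    using K unfolding sph_dir_def Let_def
    by (intro arg_cong2[where f = "(+)"] sum.cong arg_cong2[where f = "scaleR"]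
        arg_cong2[where f = "(*)"] prod.cong) auto
  then show ?thesis
    by (simp add: sph_def cd_Re_def algebra_simps)
qed

section \<open>Both exponentials satisfy the common estimates\<close>

lemma kernel_exp_compose:
  fixes V :: "'r cd \<Rightarrow> 'r cd" and c :: real
  assumes Re: "\<And>x. cd_Re (V x) = cd_Re x"
    and add: "\<And>x s. V (x + s *\<^sub>R 1) = V x + s *\<^sub>R 1"
    and deriv: "\<And>x. \<exists>D. (V has_derivative D) (at x) \<and> (\<forall>h. norm (D h) \<le> c * (1 + norm x) * norm h)"
  shows "kernel_exp (\<lambda>x. cd_exp (- V x)) (6 * max 1 c)"
proof
  fix x :: "'r cd"
  have Re': "cd_Re (- V x) = - cd_Re x"
    using Re[of x] by (simp add: cd_Re_def)
  \<comment> \<open>One constant has to serve for the value, where 2 suffices, and for the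
    derivative, where the chain rule gives 6 c.\<close>
  have "2 * exp (cd_Re (- V x)) \<le> 6 * max 1 c * exp (- cd_Re x)"
    unfolding Re' by (intro mult_right_mono) (auto simp: max_def)
  then show "norm (cd_exp (- V x)) \<le> 6 * max 1 c * exp (- cd_Re x)"
    using norm_cd_exp_le order.trans by blast
  obtain D where D: "(V has_derivative D) (at x)" "\<And>h. norm (D h) \<le> c * (1 + norm x) * norm h"
    using deriv by blast
  obtain D' where D': "(cd_exp has_derivative D') (at (- V x))"
    "\<And>h. norm (D' h) \<le> 6 * exp (cd_Re (- V x)) * norm h"
    using has_derivative_cd_exp by blast
  have "((\<lambda>x. cd_exp (- V x)) has_derivative (\<lambda>h. D' (- D h))) (at x)"
    by (rule has_derivative_compose[OF has_derivative_minus[OF D(1)] D'(1)])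
  moreover have "norm (D' (- D h)) \<le> 6 * max 1 c * (1 + norm x) * exp (- cd_Re x) * norm h" for h
  proof -
    have "c * (1 + norm x) * norm h \<le> max 1 c * (1 + norm x) * norm h"
      by (intro mult_right_mono) auto
    then have "norm (D h) \<le> max 1 c * (1 + norm x) * norm h"
      using D(2)[of h] by linarith
    then have "norm (D' (- D h)) \<le> 6 * exp (- cd_Re x) * (max 1 c * (1 + norm x) * norm h)"
      using D'(2)[of "- D h"] unfolding Re' by (smt (verit) exp_gt_zero mult_left_mono norm_minus_cancel)
    then show ?thesis by (simp only: mult_ac)
  qed
  ultimately show "\<exists>D. ((\<lambda>x. cd_exp (- V x)) has_derivative D) (at x) \<and>
      (\<forall>h. norm (D h) \<le> 6 * max 1 c * (1 + norm x) * exp (- cd_Re x) * norm h)"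
    by blast
  show "cd_exp (- V (x + s *\<^sub>R 1)) = exp (- s) *\<^sub>R cd_exp (- V x)" for s
    using cd_exp_add_real[of "- V x" "- s"] by (simp add: add)
qed

lemma kernel_exp_id: "kernel_exp (\<lambda>x :: 'r cd. cd_exp (- x)) 6"
proof -
  have "kernel_exp (\<lambda>x :: 'r cd. cd_exp (- x)) (6 * max 1 1)"
  proof (rule kernel_exp_compose)
    show "\<exists>D. ((\<lambda>x. x) has_derivative D) (at x) \<and> (\<forall>h. norm (D h) \<le> 1 * (1 + norm x) * norm h)"
      for x :: "'r cd"
      by (intro exI[of _ "\<lambda>h. h"]) (auto simp: algebra_simps)
  qed auto
  then show ?thesis by simp
qed

text \<open>The direction has bounded derivative, but it is multiplied by the coordinate x_1; this
  product is the origin of the weight 1 + |x| in \<open>kernel_exp\<close>.\<close>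

lemma kernel_exp_sph:
  assumes "2 \<le> CARD('r)"
  obtains C where "kernel_exp (\<lambda>x :: 'r cd. cd_exp (- sph x)) C"
proof -
  obtain c D where D: "0 \<le> c" "\<And>x :: 'r cd. norm (sph_dir x) \<le> c"
    "\<And>x :: 'r cd. (sph_dir has_derivative D x) (at x)" "\<And>x h. norm (D x h) \<le> c * norm h"
    using bdd_C1E[OF bdd_C1_sph_dir] by metis
  have "\<exists>D. (sph has_derivative D) (at x) \<and> (\<forall>h. norm (D h) \<le> (1 + c) * (1 + norm x) * norm h)"
    for x :: "'r cd"
  proof (intro exI conjI allI)
    show "(sph has_derivative (\<lambda>h. cd_Re h *\<^sub>R 1 + (cd_coord x 1 *\<^sub>R D x h + cd_coord h 1 *\<^sub>R sph_dir x))) (at x)"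
      unfolding sph_def[abs_def]
      by (intro has_derivative_add has_derivative_scaleR has_derivative_scaleR_left D
          bounded_linear.has_derivative[OF bounded_linear_cd_Re has_derivative_ident]
          bounded_linear.has_derivative[OF bounded_linear_cd_coord has_derivative_ident])
    fix h
    have "norm (cd_coord x 1 *\<^sub>R D x h) \<le> norm x * (c * norm h)"
      unfolding norm_scaleR by (intro mult_mono D) (auto intro: abs_cd_coord_le)
    moreover have "norm (cd_coord h 1 *\<^sub>R sph_dir x) \<le> norm h * c"
      unfolding norm_scaleR by (intro mult_mono D) (auto intro: abs_cd_coord_le)
    moreover have "norm (cd_Re h *\<^sub>R (1 :: 'r cd)) \<le> norm h"
      by (simp add: cd_Re_le_norm)
    ultimately have "norm (cd_Re h *\<^sub>R 1 + (cd_coord x 1 *\<^sub>R D x h + cd_coord h 1 *\<^sub>R sph_dir x))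
        \<le> norm h + (norm x * (c * norm h) + norm h * c)"
      by (intro norm_triangle_le add_mono)
    also have "\<dots> \<le> (1 + c) * (1 + norm x) * norm h"
      by (simp add: algebra_simps)
    finally show "norm (cd_Re h *\<^sub>R 1 + (cd_coord x 1 *\<^sub>R D x h + cd_coord h 1 *\<^sub>R sph_dir x))
        \<le> (1 + c) * (1 + norm x) * norm h" .
  qed
  then show ?thesis
    using that kernel_exp_compose[OF cd_Re_sph[OF assms] sph_add_real[OF assms]] by blast
qed

text \<open>The diagonal entries of \<open>T\<^sub>t\<close>; for both kernels entry \<open>0\<close> is \<open>s\<^sub>1\<close>.\<close>

definition cart_coeff :: "real ^ 'n::{finite,linorder} \<Rightarrow> nat \<Rightarrow> real" where
  "cart_coeff t m = (if m = 0 then tsum t 1 else tc t m)"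

definition sph_coeff :: "real ^ 'n::{finite,linorder} \<Rightarrow> nat \<Rightarrow> real" where
  "sph_coeff t m = tsum t (max 1 m)"

section \<open>The derivative formula for a kernel with diagonal T\<close>

lemma kernel_C_eq:
  fixes t :: "real ^ 'n::{finite,linorder}"
  assumes "CARD('n) < 2 ^ CARD('r)"
  shows "kernel_C p t \<zeta> =
    cd_diag CARD('n) (cart_coeff t) p + cd_trunc CARD('n) (\<zeta> :: 'r cd)"
proof -
  have "(cd_coord p 0 * tsum t 1) *\<^sub>R 1 + (\<Sum>j = 1..CARD('n). (cd_coord p j * tc t j) *\<^sub>R cd_unit j) =
      cd_diag CARD('n) (cart_coeff t) p"
    by (rule cd_eqI) (auto simp: cd_coord_sum_unit cd_diag_def cart_coeff_def simp del: cd_coord_sum)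
  then show ?thesis by (simp add: kernel_C_def)
qed

lemma kernel_S_eq:
  fixes t :: "real ^ 'n::{finite,linorder}"
  assumes "CARD('n) < 2 ^ CARD('r)"
  shows "kernel_S p t \<zeta> =
    sph (cd_diag CARD('n) (sph_coeff t) p + cd_trunc CARD('n) (\<zeta> :: 'r cd))"
proof -
  define x where "x = cd_diag CARD('n) (sph_coeff t) p + cd_trunc CARD('n) (\<zeta> :: 'r cd)"
  \<comment> \<open>The kernel reads the angles only at indices j \<ge> 1, where
    \<open>max 1 j\<close> is j. Above n both sides are 0.\<close>
  have \<phi>: "cd_coord (cd_trunc CARD('n) p) j * tsum t j + cd_coord (cd_trunc CARD('n) \<zeta>) j = cd_coord x j"
    if "j \<noteq> 0" for j
    using that by (simp add: x_def cd_diag_def cd_trunc_def sph_coeff_def)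
  have Re: "cd_Re x = cd_coord p 0 * tsum t 1 + cd_coord \<zeta> 0"
    by (simp add: x_def cd_diag_def cd_trunc_def sph_coeff_def cd_Re_def)
  have "kernel_S p t \<zeta> = (cd_coord p 0 * tsum t 1) *\<^sub>R 1 + cd_coord x 1 *\<^sub>R sph_dir x + cd_coord \<zeta> 0 *\<^sub>R 1"
    unfolding kernel_S_def sph_dir_def Let_def
    by (intro arg_cong2[where f = "(+)"] sum.cong arg_cong2[where f = "scaleR"]
        arg_cong2[where f = "(*)"] prod.cong refl arg_cong[where f = sin] arg_cong[where f = cos] \<phi>) auto
  then show ?thesis
    unfolding x_def[symmetric] by (simp add: sph_def Re algebra_simps)
qed

text \<open>Since T i_j = \<tau>_j i_j, the p-derivative of the integrand in direction i_j is
  \<tau>_j times its \<zeta>_j-derivative. The real scalar \<tau>_j can be moved onto f, which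
  produces the transforms of \<tau>_j f.\<close>

lemma (in kernel_exp) frechet_derivative_transform:
  fixes f :: "real ^ 'n::{finite,linorder} \<Rightarrow> 'r cd" and \<tau> :: "real ^ 'n::{finite,linorder} \<Rightarrow> nat \<Rightarrow> real"
    and u :: "'r cd \<Rightarrow> real ^ 'n::{finite,linorder} \<Rightarrow> 'r cd \<Rightarrow> 'r cd" and h :: "nat \<Rightarrow> real"
  assumes n: "CARD('n) < 2 ^ CARD('r)"
    and f: "original a f" and p: "p \<in> strip a"
    and \<tau>_0: "\<And>t. \<tau> t 0 = tsum t 1"
    and \<tau>_le: "\<And>t m. \<bar>\<tau> t m\<bar> \<le> real CARD('n) * abs_sum t"
    and \<tau>_cont: "\<And>m. continuous_on UNIV (\<lambda>t. \<tau> t m)"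
    and u: "\<And>q t \<zeta>. cd_exp (- u q t \<zeta>) = E (cd_diag CARD('n) (\<tau> t) q + cd_trunc CARD('n) \<zeta>)"
  shows "(\<lambda>q. transform f u q \<zeta>) differentiable (at p)"
    and "integrable lebesgue (integrand f u p \<zeta>)"
    and "\<And>k. integrable lebesgue (integrand (\<lambda>t. \<tau> t k *\<^sub>R f t) u p \<zeta>)"
    and "\<And>k. k \<le> CARD('n) \<Longrightarrow> S_defined k (transform (\<lambda>t. \<tau> t k *\<^sub>R f t) u p) \<zeta>"
    and "frechet_derivative (\<lambda>q. transform f u q \<zeta>) (at p) (\<Sum>j = 0..CARD('n). h j *\<^sub>R cd_unit j) =
        - (h 0 *\<^sub>R transform (\<lambda>t. \<tau> t 0 *\<^sub>R f t) u p \<zeta>)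
        - (\<Sum>k = 1..CARD('n). h k *\<^sub>R S_op k (transform (\<lambda>t. \<tau> t k *\<^sub>R f t) u p) \<zeta>)"
proof -
  define N where "N = CARD('n)"
  define M where "M = (\<lambda>t :: real ^ 'n::{finite,linorder}. cd_diag N (\<tau> t) :: 'r cd \<Rightarrow> 'r cd)"
  define x where "x = (\<lambda>t. M t p + cd_trunc N \<zeta>)"
  \<comment> \<open>One B for all linear bounds: the first summand covers T and T p as well as each
    \<tau>_m, the second the shift by \<zeta>, and the 1 covers the unit vectors and the constant
    weight.\<close>
  define B where "B = 2 ^ CARD('r) * real N * (1 + norm p) + norm (cd_trunc N \<zeta>) + 1"
  obtain A d where d: "0 < d"
    and A: "\<And>t. norm (f t) * exp (- (cd_Re p * tsum t 1)) \<le> A * exp (- d * abs_sum t)"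
    using original_growth[OF f p] by blast
  have f_meas: "f \<in> borel_measurable lebesgue"
    using f by (rule original_borel_measurable)
  have \<tau>_meas: "(\<lambda>t. \<tau> t m) \<in> borel_measurable lebesgue" for m
    by (intro continuous_imp_borel_measurable_lebesgue \<tau>_cont)
  have M_meas: "(\<lambda>t. M t q) \<in> borel_measurable lebesgue" for q
    unfolding M_def by (intro borel_measurable_cd_diag \<tau>_cont)
  then have x_meas: "x \<in> borel_measurable lebesgue"
    unfolding x_def by (intro borel_measurable_add borel_measurable_const)
  have lin: "bounded_linear (M t)" for t
    unfolding M_def by (rule bounded_linear_cd_diag)
  have 2: "1 \<le> (2::real) ^ CARD('r)"
    by (rule one_le_power) simp
  have B1: "1 \<le> B" and BN: "2 ^ CARD('r) * real N \<le> B"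
    by (auto simp: B_def algebra_simps)
  have "1 * real N \<le> 2 ^ CARD('r) * real N"
    using 2 by (intro mult_right_mono) auto
  then have "real N \<le> B"
    using BN by simp
  then have gB: "\<bar>\<tau> t m\<bar> \<le> B * (1 + abs_sum t)" for t m
    using \<tau>_le[of t m] unfolding N_def by (smt (verit) abs_sum_nonneg mult_mono B1 N_def)
  have M_le: "norm (M t q) \<le> 2 ^ CARD('r) * (real N * abs_sum t) * norm q" for t q
    unfolding M_def by (rule norm_cd_diag_le) (use \<tau>_le in \<open>auto simp: N_def\<close>)
  have MB: "norm (M t q) \<le> B * (1 + abs_sum t) * norm q" for t q
  proof -
    have "2 ^ CARD('r) * (real N * abs_sum t) = (2 ^ CARD('r) * real N) * abs_sum t"
      by simp
    also have "\<dots> \<le> B * (1 + abs_sum t)"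
      using BN B1 by (intro mult_mono) auto
    finally show ?thesis
      using M_le[of t q] by (smt (verit) mult_right_mono norm_ge_zero)
  qed
  have xB: "norm (x t) \<le> B * (1 + abs_sum t)" for t
  proof -
    have "norm (x t) \<le> 2 ^ CARD('r) * (real N * abs_sum t) * norm p + norm (cd_trunc N \<zeta>)"
      unfolding x_def by (intro norm_triangle_le add_mono M_le order.refl)
    also have "\<dots> \<le> B * (1 + abs_sum t)"
      by (simp add: B_def algebra_simps)
    finally show ?thesis .
  qed
  \<comment> \<open>Only entry 0 of T reaches the real part, so the exponent is the one controlled
    by \<open>original_growth\<close>, up to the constant Re \<zeta>.\<close>
  have Re_x: "cd_Re (x t) = cd_Re p * tsum t 1 + cd_Re \<zeta>" for t
    by (simp add: x_def M_def cd_Re_def cd_diag_def cd_trunc_def \<tau>_0)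
  have fx: "norm (f t) * exp (- cd_Re (x t)) \<le> (A * exp (- cd_Re \<zeta>)) * exp (- d * abs_sum t)" for t
  proof -
    have "norm (f t) * exp (- cd_Re (x t)) = (norm (f t) * exp (- (cd_Re p * tsum t 1))) * exp (- cd_Re \<zeta>)"
      by (simp add: Re_x mult.assoc exp_add[symmetric])
    also have "\<dots> \<le> (A * exp (- d * abs_sum t)) * exp (- cd_Re \<zeta>)"
      by (intro mult_right_mono A) auto
    finally show ?thesis by (simp add: mult_ac)
  qed
  have B0: "0 \<le> B" using B1 by simp
  have integrand: "integrand g u p \<zeta> = (\<lambda>t. g t * E (x t))" for g
    by (simp add: integrand_def[abs_def] u x_def M_def N_def)
  have 1: "\<bar>1\<bar> \<le> B * (1 + abs_sum t)" for t :: "real ^ 'n::{finite,linorder}"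
    using mult_mono[of 1 B 1 "1 + abs_sum t"] B1 by simp
  note Tp = has_derivative_transform[OF f_meas borel_measurable_const x_meas M_meas lin d B0 fx 1 xB MB]
  define I where "I = (\<lambda>k. \<integral>t. (\<tau> t k *\<^sub>R f t) * E' (x t) (cd_unit k) \<partial>lebesgue)"
  have F: "((\<lambda>q. transform f u q \<zeta>) has_derivative (\<lambda>h. \<integral>t. f t * E' (x t) (M t h) \<partial>lebesgue)) (at p)"
  proof -
    have "x t + M t (q - p) = M t q + cd_trunc N \<zeta>" for q t
      by (simp add: x_def linear_diff[OF bounded_linear.linear[OF lin]])
    then have "(\<lambda>q. \<integral>t. f t * E (x t + M t (q - p)) \<partial>lebesgue) = (\<lambda>q. transform f u q \<zeta>)"
      by (simp add: transform_def integrand_def[abs_def] u M_def N_def)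
    then show ?thesis
      using Tp(3)[of p] by simp
  qed
  show "(\<lambda>q. transform f u q \<zeta>) differentiable (at p)"
    using F by (rule differentiableI)
  show "integrable lebesgue (integrand f u p \<zeta>)"
    unfolding integrand using Tp(1) by simp
  have unit_lin: "bounded_linear (\<lambda>s :: real. s *\<^sub>R (cd_unit k :: 'r cd))" for k
    by (rule bounded_linear_scaleR_left)
  have unit_B: "norm (s *\<^sub>R (cd_unit k :: 'r cd)) \<le> B * (1 + abs_sum t) * norm s"
    if "k \<le> N" for k s and t :: "real ^ 'n::{finite,linorder}"
  proof -
    have "cd_unit k \<in> (Basis :: 'r cd set)"
      using that n by (auto simp: Basis_cd_def N_def)
    then show ?thesis
      using mult_right_mono[OF 1[of t], of "\<bar>s\<bar>"] by simp
  qed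
  note Tk = has_derivative_transform[OF f_meas \<tau>_meas x_meas borel_measurable_const unit_lin d B0 fx gB xB
      unit_B]
  have "bounded_linear (\<lambda>s :: real. 0 :: 'r cd)"
    by simp
  \<comment> \<open>With M = 0 only the integrability at the base point is of interest; it is
    obtained for every k, whereas \<open>unit_B\<close> asks for k \<le> n.\<close>
  note T0 = has_derivative_transform[OF f_meas \<tau>_meas x_meas borel_measurable_const this d B0 fx gB xB]
  show "integrable lebesgue (integrand (\<lambda>t. \<tau> t k *\<^sub>R f t) u p \<zeta>)" for k
    unfolding integrand by (rule T0(1)) (use B0 in auto)
  have Tk_unit: "((\<lambda>s. transform (\<lambda>t. \<tau> t k *\<^sub>R f t) u p (\<zeta> + s *\<^sub>R cd_unit k)) has_vector_derivative I k) (at 0)"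
    if k: "k \<le> N" for k
  proof -
    have "cd_trunc N (\<zeta> + s *\<^sub>R cd_unit k) = cd_trunc N \<zeta> + s *\<^sub>R cd_unit k" for s
      by (rule cd_eqI) (use k in \<open>auto simp: cd_trunc_def\<close>)
    then have "(\<lambda>s. transform (\<lambda>t. \<tau> t k *\<^sub>R f t) u p (\<zeta> + s *\<^sub>R cd_unit k)) =
        (\<lambda>s. \<integral>t. (\<tau> t k *\<^sub>R f t) * E (x t + (s - 0) *\<^sub>R cd_unit k) \<partial>lebesgue)"
      by (simp add: transform_def integrand_def[abs_def] u x_def M_def N_def add.assoc)
    moreover have "(\<tau> t k *\<^sub>R f t) * E' (x t) (s *\<^sub>R cd_unit k) = s *\<^sub>R ((\<tau> t k *\<^sub>R f t) * E' (x t) (cd_unit k))" for s t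
      by (simp add: linear_scale[OF has_derivative_linear[OF deriv_E]] cd_mult.scaleR_right)
    then have "(\<lambda>s. \<integral>t. (\<tau> t k *\<^sub>R f t) * E' (x t) (s *\<^sub>R cd_unit k) \<partial>lebesgue) = (\<lambda>s. s *\<^sub>R I k)"
      by (simp add: I_def)
    ultimately show ?thesis
      using Tk(3)[OF k, of k 0] unfolding has_vector_derivative_def by simp
  qed
  show "S_defined k (transform (\<lambda>t. \<tau> t k *\<^sub>R f t) u p) \<zeta>" if "k \<le> CARD('n)" for k
    unfolding S_defined_def using Tk_unit[of k] that
    by (auto simp: N_def has_vector_derivative_def intro: differentiableI)
  have S_op: "S_op k (transform (\<lambda>t. \<tau> t k *\<^sub>R f t) u p) \<zeta> = - I k" if "k \<le> N" for k
    unfolding S_op_def using vector_derivative_at[OF Tk_unit[OF that]] by simp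
  \<comment> \<open>The index 0 direction is the unit 1, so \<open>E'_one\<close> turns this
    integral into minus the transform itself.\<close>
  have I_0: "I 0 = - transform (\<lambda>t. \<tau> t 0 *\<^sub>R f t) u p \<zeta>"
    by (simp add: I_def transform_def integrand one_cd_def[symmetric] E'_one cd_mult.minus_right)
  have "M t (\<Sum>j = 0..N. h j *\<^sub>R cd_unit j) = (\<Sum>j = 0..N. (h j * \<tau> t j) *\<^sub>R cd_unit j)" for t
    by (rule cd_eqI) (simp add: M_def cd_diag_def cd_coord_sum_unit del: cd_coord_sum)
  then have "f t * E' (x t) (M t (\<Sum>j = 0..N. h j *\<^sub>R cd_unit j)) =
      (\<Sum>j = 0..N. h j *\<^sub>R ((\<tau> t j *\<^sub>R f t) * E' (x t) (cd_unit j)))" for t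
    by (simp add: linear_sum[OF has_derivative_linear[OF deriv_E]]
        linear_scale[OF has_derivative_linear[OF deriv_E]]
        cd_mult.sum_right cd_mult.scaleR_left cd_mult.scaleR_right)
  moreover have "integrable lebesgue (\<lambda>t. (\<tau> t j *\<^sub>R f t) * E' (x t) (cd_unit j))" if "j \<le> N" for j
    using Tk(2)[OF that, of j 1] by simp
  ultimately have "(\<integral>t. f t * E' (x t) (M t (\<Sum>j = 0..N. h j *\<^sub>R cd_unit j)) \<partial>lebesgue) =
      (\<Sum>j = 0..N. h j *\<^sub>R I j)"
    by (simp add: I_def Bochner_Integration.integral_sum)
  also have "\<dots> = h 0 *\<^sub>R I 0 + (\<Sum>k = 1..N. h k *\<^sub>R I k)"
    by (simp add: sum.atLeast_Suc_atMost)
  also have "\<dots> = - (h 0 *\<^sub>R transform (\<lambda>t. \<tau> t 0 *\<^sub>R f t) u p \<zeta>)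
        - (\<Sum>k = 1..N. h k *\<^sub>R S_op k (transform (\<lambda>t. \<tau> t k *\<^sub>R f t) u p) \<zeta>)"
    by (simp add: I_0 S_op sum_negf)
  finally show "frechet_derivative (\<lambda>q. transform f u q \<zeta>) (at p) (\<Sum>j = 0..CARD('n). h j *\<^sub>R cd_unit j) =
        - (h 0 *\<^sub>R transform (\<lambda>t. \<tau> t 0 *\<^sub>R f t) u p \<zeta>)
        - (\<Sum>k = 1..CARD('n). h k *\<^sub>R S_op k (transform (\<lambda>t. \<tau> t k *\<^sub>R f t) u p) \<zeta>)"
    unfolding frechet_derivative_at[OF F, symmetric] N_def .
qed

text \<open>Derivatives and integrals are total functions with default values, so differentiability,
  integrability and the existence of each \<zeta>_k-derivative are asserted along with the
  formulas.\<close>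

theorem theorem13:
  fixes r n :: nat
    and f :: "real ^ 'n::{finite,linorder} \<Rightarrow> 'r cd"
    and a :: "int \<Rightarrow> real"
    and p \<zeta> :: "'r cd"
    and h :: "nat \<Rightarrow> real"
  assumes "CARD('r) = r" and "CARD('n) = n"
    and "2 \<le> r" and "2 ^ (r - 1) \<le> n" and "n \<le> 2 ^ r - 1"
    and "original a f"
    and "p \<in> strip a"
  shows
    "((\<lambda>q. transform f kernel_S q \<zeta>) differentiable (at p) \<and>
      integrable lebesgue (integrand f kernel_S p \<zeta>) \<and>
      (\<forall>k\<in>{1..n}. integrable lebesgue (integrand (\<lambda>t. tsum t k *\<^sub>R f t) kernel_S p \<zeta>) \<and>
        S_defined k (transform (\<lambda>t. tsum t k *\<^sub>R f t) kernel_S p) \<zeta>) \<and>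
      frechet_derivative (\<lambda>q. transform f kernel_S q \<zeta>) (at p) (\<Sum>j = 0..n. h j *\<^sub>R cd_unit j) =
        - (h 0 *\<^sub>R transform (\<lambda>t. tsum t 1 *\<^sub>R f t) kernel_S p \<zeta>)
        - (\<Sum>k = 1..n. h k *\<^sub>R S_op k (transform (\<lambda>t. tsum t k *\<^sub>R f t) kernel_S p) \<zeta>))
     \<and>
     ((\<lambda>q. transform f kernel_C q \<zeta>) differentiable (at p) \<and>
      integrable lebesgue (integrand f kernel_C p \<zeta>) \<and>
      integrable lebesgue (integrand (\<lambda>t. tsum t 1 *\<^sub>R f t) kernel_C p \<zeta>) \<and>
      (\<forall>k\<in>{1..n}. integrable lebesgue (integrand (\<lambda>t. tc t k *\<^sub>R f t) kernel_C p \<zeta>) \<and>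
        S_defined k (transform (\<lambda>t. tc t k *\<^sub>R f t) kernel_C p) \<zeta>) \<and>
      frechet_derivative (\<lambda>q. transform f kernel_C q \<zeta>) (at p) (\<Sum>j = 0..n. h j *\<^sub>R cd_unit j) =
        - (h 0 *\<^sub>R transform (\<lambda>t. tsum t 1 *\<^sub>R f t) kernel_C p \<zeta>)
        - (\<Sum>k = 1..n. h k *\<^sub>R S_op k (transform (\<lambda>t. tc t k *\<^sub>R f t) kernel_C p) \<zeta>))"
proof -
  have n_lt: "CARD('n) < 2 ^ CARD('r)"
  proof -
    \<comment> \<open>Positivity turns the truncated subtraction in n \<le> 2 ^ r - 1 into n < 2 ^
      r, which makes every i_k with k \<le> n a basis element.\<close>
    have "0 < (2::nat) ^ r" by simp
    then have "n < 2 ^ r" using assms(5) by linarith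
    then show ?thesis using assms(1,2) by simp
  qed
  have tc_le: "\<bar>tc t m\<bar> \<le> real CARD('n) * abs_sum t" for t :: "real ^ 'n::{finite,linorder}" and m
  proof -
    have "1 * abs_sum t \<le> real CARD('n) * abs_sum t"
      by (intro mult_right_mono) (auto simp: Suc_leI)
    then show ?thesis
      using abs_tc_le[of t m] by linarith
  qed
  obtain C where "kernel_exp (\<lambda>x :: 'r cd. cd_exp (- sph x)) C"
    using kernel_exp_sph assms(1,3) by metis
  then interpret S: kernel_exp "\<lambda>x :: 'r cd. cd_exp (- sph x)" C .
  interpret C: kernel_exp "\<lambda>x :: 'r cd. cd_exp (- x)" 6
    by (rule kernel_exp_id)
  have cart_cont: "continuous_on UNIV (\<lambda>t :: real ^ 'n::{finite,linorder}. cart_coeff t m)" for m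
    by (cases "m = 0") (simp_all add: cart_coeff_def continuous_on_tsum continuous_on_tc)
  note S = S.frechet_derivative_transform[where \<tau> = sph_coeff and u = kernel_S and f = f, OF n_lt assms(6,7)]
  note C = C.frechet_derivative_transform[where \<tau> = cart_coeff and u = kernel_C and f = f, OF n_lt assms(6,7)]
  have S_hyps: "sph_coeff t 0 = tsum t 1" "\<bar>sph_coeff t m\<bar> \<le> real CARD('n) * abs_sum t"
    "continuous_on UNIV (\<lambda>t :: real ^ 'n::{finite,linorder}. sph_coeff t m)"
    "cd_exp (- kernel_S q t \<zeta>) =
      cd_exp (- sph (cd_diag CARD('n) (sph_coeff t) q + cd_trunc CARD('n) (\<zeta> :: 'r cd)))"
    for t :: "real ^ 'n::{finite,linorder}" and m q \<zeta>
    by (auto simp: sph_coeff_def kernel_S_eq[OF n_lt] intro: continuous_on_tsum abs_tsum_le simp del: One_nat_def)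
  have C_hyps: "cart_coeff t 0 = tsum t 1" "\<bar>cart_coeff t m\<bar> \<le> real CARD('n) * abs_sum t"
    "continuous_on UNIV (\<lambda>t :: real ^ 'n::{finite,linorder}. cart_coeff t m)"
    "cd_exp (- kernel_C q t \<zeta>) =
      cd_exp (- (cd_diag CARD('n) (cart_coeff t) q + cd_trunc CARD('n) (\<zeta> :: 'r cd)))"
    for t :: "real ^ 'n::{finite,linorder}" and m q \<zeta>
    by (rule cart_cont | simp add: cart_coeff_def kernel_C_eq[OF n_lt] abs_tsum_le tc_le del: One_nat_def)+
  have coeff_0: "sph_coeff t 0 = tsum t 1" "cart_coeff t 0 = tsum t 1" for t :: "real ^ 'n::{finite,linorder}"
    by (simp_all add: sph_coeff_def cart_coeff_def)
  have coeff_pos: "sph_coeff t k = tsum t k" "cart_coeff t k = tc t k" if "k \<in> {1..n}" for t :: "real ^ 'n::{finite,linorder}" and k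
    using that by (simp_all add: sph_coeff_def cart_coeff_def)
  show ?thesis
  proof (intro conjI ballI)
    fix k assume k: "k \<in> {1..n}"
    then have "k \<le> CARD('n)" using assms(2) by simp
    then show "S_defined k (transform (\<lambda>t. tsum t k *\<^sub>R f t) kernel_S p) \<zeta>"
      "S_defined k (transform (\<lambda>t. tc t k *\<^sub>R f t) kernel_C p) \<zeta>"
      using S(4)[OF S_hyps, of k] C(4)[OF C_hyps, of k] by (simp_all add: coeff_pos[OF k])
    show "integrable lebesgue (integrand (\<lambda>t. tsum t k *\<^sub>R f t) kernel_S p \<zeta>)"
      "integrable lebesgue (integrand (\<lambda>t. tc t k *\<^sub>R f t) kernel_C p \<zeta>)"
      using S(3)[OF S_hyps, where k = k and \<zeta> = \<zeta>] C(3)[OF C_hyps, where k = k and \<zeta> = \<zeta>] by (simp_all add: coeff_pos[OF k])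
  next
    show "integrable lebesgue (integrand (\<lambda>t. tsum t 1 *\<^sub>R f t) kernel_C p \<zeta>)"
      using C(3)[OF C_hyps, where k = 0 and \<zeta> = \<zeta>] by (simp only: coeff_0)
    show "frechet_derivative (\<lambda>q. transform f kernel_S q \<zeta>) (at p) (\<Sum>j = 0..n. h j *\<^sub>R cd_unit j) =
        - (h 0 *\<^sub>R transform (\<lambda>t. tsum t 1 *\<^sub>R f t) kernel_S p \<zeta>)
        - (\<Sum>k = 1..n. h k *\<^sub>R S_op k (transform (\<lambda>t. tsum t k *\<^sub>R f t) kernel_S p) \<zeta>)"
      using S(5)[OF S_hyps, where h = h and \<zeta> = \<zeta>] assms(2) by (simp only: coeff_0 coeff_pos cong: sum.cong)
    show "frechet_derivative (\<lambda>q. transform f kernel_C q \<zeta>) (at p) (\<Sum>j = 0..n. h j *\<^sub>R cd_unit j) =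
        - (h 0 *\<^sub>R transform (\<lambda>t. tsum t 1 *\<^sub>R f t) kernel_C p \<zeta>)
        - (\<Sum>k = 1..n. h k *\<^sub>R S_op k (transform (\<lambda>t. tc t k *\<^sub>R f t) kernel_C p) \<zeta>)"
      using C(5)[OF C_hyps, where h = h and \<zeta> = \<zeta>] assms(2) by (simp only: coeff_0 coeff_pos cong: sum.cong)
  qed (rule S(1,2)[OF S_hyps] C(1,2)[OF C_hyps])+
qed

end
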